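(* Let $V$ be a real vector space of finite dimension $m\ge 3$, and let $\mathcal{A}\in\mathfrak{A}(V)$ be a generalized algebraic curvature operator. Then: (1) If $\mathcal{A}$ is Ricci symmetric, there exists a Ricci symmetric torsion free connection $\nabla$ on $TV$ such that $\mathcal{R}^\nabla_0=\mathcal{A}$. (2) If $\mathcal{A}$ is Ricci antisymmetric, there exists a Ricci antisymmetric torsion free connection $\nabla$ on $TV$ such that $\mathcal{R}^\nabla_0=\mathcal{A}$. (3) If $\mathcal{A}$ is Ricci flat, there exists a Ricci flat torsion free connection $\nabla$ on $TV$ such that $\mathcal{R}^\nabla_0=\mathcal{A}$.
   Context: The space $V$ is regarded as a smooth manifold, with $T_PV$ identified with $V$ in the canonical way for every $P\in V$. A generalized algebraic curvature operator on $V$ is a tensor $\mathcal{A}\in\otimes^2V^*\otimes\operatorname{End}(V)$ with $\mathcal{A}(x,y)=-\mathcal{A}(y,x)$ and $\mathcal{A}(x,y)z+\mathcal{A}(y,z)x+\mathcal{A}(z,x)y=0$ for all $x,y,z\in V$; $\mathfrak{A}(V)$ is the space of all such operators. The Ricci tensor of $\mathcal{A}$ is the bilinear form $\rho(\mathcal{A})(x,y):=\operatorname{Tr}\{z\mapsto\mathcal{A}(z,x)y\}$. $\mathcal{A}$ is Ricci symmetric if $\rho(\mathcal{A})$ is a symmetric bilinear form, Ricci antisymmetric if $\rho(\mathcal{A})$ is an antisymmetric bilinear form, and Ricci flat if $\rho(\mathcal{A})=0$. For a torsion free connection $\nabla$ on the tangent bundle, the curvature operator is $\mathcal{R}^\nabla(x,y):=\nabla_x\nabla_y-\nabla_y\nabla_x-\nabla_{[x,y]}$,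 and $\mathcal{R}^\nabla_P\in\mathfrak{A}(T_PV)$ denotes its value at the point $P$. The connection $\nabla$ is Ricci symmetric (resp. Ricci antisymmetric, Ricci flat) if $\mathcal{R}^\nabla_P$ is Ricci symmetric (resp. Ricci antisymmetric, Ricci flat) for every point $P$. *)

theory Defs
  imports "HOL-Analysis.Analysis"
begin

text \<open>
  The vector space \<open>V\<close> is the type \<open>'a::euclidean_space\<close>. Its inner product occurs below only in
  \<open>endo_trace\<close>, whose value on a linear map does not depend on it.
\<close>

subsection \<open>Generalized algebraic curvature operators\<close>

text \<open>The argument order is \<open>A x y z = \<A>(x,y)z\<close>.\<close>

definition curvature_operators :: "('a::real_vector \<Rightarrow> 'a \<Rightarrow> 'a \<Rightarrow> 'a) set" where
  "curvature_operators =
    {A. (\<forall>y z. linear (\<lambda>x. A x y z)) \<and> (\<forall>x z. linear (\<lambda>y. A x y z)) \<and> (\<forall>x y. linear (A x y)) \<and>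
        (\<forall>x y z. A x y z = - A y x z) \<and>
        (\<forall>x y z. A x y z + A y z x + A z x y = 0)}"

text \<open>The trace of an endomorphism, computed in the standard orthonormal basis.\<close>

definition endo_trace :: "('a::euclidean_space \<Rightarrow> 'a) \<Rightarrow> real" where
  "endo_trace T = (\<Sum>b\<in>Basis. T b \<bullet> b)"

definition ricci :: "('a::euclidean_space \<Rightarrow> 'a \<Rightarrow> 'a \<Rightarrow> 'a) \<Rightarrow> 'a \<Rightarrow> 'a \<Rightarrow> real" where
  "ricci A x y = endo_trace (\<lambda>z. A z x y)"

definition ricci_symmetric :: "('a::euclidean_space \<Rightarrow> 'a \<Rightarrow> 'a \<Rightarrow> 'a) \<Rightarrow> bool" where
  "ricci_symmetric A \<longleftrightarrow> (\<forall>x y. ricci A x y = ricci A y x)"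

definition ricci_antisymmetric :: "('a::euclidean_space \<Rightarrow> 'a \<Rightarrow> 'a \<Rightarrow> 'a) \<Rightarrow> bool" where
  "ricci_antisymmetric A \<longleftrightarrow> (\<forall>x y. ricci A x y = - ricci A y x)"

definition ricci_flat :: "('a::euclidean_space \<Rightarrow> 'a \<Rightarrow> 'a \<Rightarrow> 'a) \<Rightarrow> bool" where
  "ricci_flat A \<longleftrightarrow> (\<forall>x y. ricci A x y = 0)"

subsection \<open>Smooth functions and vector fields on \<open>V\<close>\<close>

text \<open>
  Since \<open>V\<close> is finite-dimensional, \<open>f\<close> is of class \<open>C\<^sup>k\<^sup>+\<^sup>1\<close> iff it is differentiable and all its
  directional derivatives are of class \<open>C\<^sup>k\<close>.
\<close>

primrec Ck :: "nat \<Rightarrow> ('a::euclidean_space \<Rightarrow> 'b::real_normed_vector) \<Rightarrow> bool" where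
  "Ck 0 f \<longleftrightarrow> continuous_on UNIV f"
| "Ck (Suc k) f \<longleftrightarrow>
     (\<forall>P. f differentiable (at P)) \<and> (\<forall>v. Ck k (\<lambda>P. frechet_derivative f (at P) v))"

definition smooth :: "('a::euclidean_space \<Rightarrow> 'b::real_normed_vector) \<Rightarrow> bool" where
  "smooth f \<longleftrightarrow> (\<forall>k. Ck k f)"

text \<open>
  As every \<open>T\<^sub>PV\<close> is identified with \<open>V\<close>, a vector field on \<open>V\<close> is a smooth function
  \<open>'a \<Rightarrow> 'a\<close>. The function \<open>dir_deriv X f\<close> is \<open>P \<mapsto> df\<^sub>P(X\<^sub>P)\<close>.
\<close>

definition dir_deriv ::
    "('a::euclidean_space \<Rightarrow> 'a) \<Rightarrow> ('a \<Rightarrow> 'b::real_normed_vector) \<Rightarrow> 'a \<Rightarrow> 'b" where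
  "dir_deriv X f P = frechet_derivative f (at P) (X P)"

definition lie_bracket ::
    "('a::euclidean_space \<Rightarrow> 'a) \<Rightarrow> ('a \<Rightarrow> 'a) \<Rightarrow> 'a \<Rightarrow> 'a" where
  "lie_bracket X Y = (\<lambda>P. dir_deriv X Y P - dir_deriv Y X P)"

subsection \<open>Connections on the tangent bundle of \<open>V\<close>\<close>

text \<open>
  A connection is a covariant derivative \<open>nabla X Y = \<nabla>\<^sub>X Y\<close>. Only its values on smooth vector
  fields are meaningful.
\<close>

locale connection =
  fixes nabla :: "('a::euclidean_space \<Rightarrow> 'a) \<Rightarrow> ('a \<Rightarrow> 'a) \<Rightarrow> ('a \<Rightarrow> 'a)"
  assumes smooth_nabla: "smooth X \<Longrightarrow> smooth Y \<Longrightarrow> smooth (nabla X Y)"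
    and add_left: "smooth X \<Longrightarrow> smooth X' \<Longrightarrow> smooth Y \<Longrightarrow>
      nabla (\<lambda>P. X P + X' P) Y = (\<lambda>P. nabla X Y P + nabla X' Y P)"
    and scale_left: "smooth (f :: 'a \<Rightarrow> real) \<Longrightarrow> smooth X \<Longrightarrow> smooth Y \<Longrightarrow>
      nabla (\<lambda>P. f P *\<^sub>R X P) Y = (\<lambda>P. f P *\<^sub>R nabla X Y P)"
    and add_right: "smooth X \<Longrightarrow> smooth Y \<Longrightarrow> smooth Y' \<Longrightarrow>
      nabla X (\<lambda>P. Y P + Y' P) = (\<lambda>P. nabla X Y P + nabla X Y' P)"
    and leibniz: "smooth (f :: 'a \<Rightarrow> real) \<Longrightarrow> smooth X \<Longrightarrow> smooth Y \<Longrightarrow>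
      nabla X (\<lambda>P. f P *\<^sub>R Y P) = (\<lambda>P. dir_deriv X f P *\<^sub>R Y P + f P *\<^sub>R nabla X Y P)"

locale torsion_free_connection = connection +
  assumes torsion_free: "smooth X \<Longrightarrow> smooth Y \<Longrightarrow>
      (\<lambda>P. nabla X Y P - nabla Y X P) = lie_bracket X Y"

definition curvature ::
    "(('a::euclidean_space \<Rightarrow> 'a) \<Rightarrow> ('a \<Rightarrow> 'a) \<Rightarrow> ('a \<Rightarrow> 'a)) \<Rightarrow>
     ('a \<Rightarrow> 'a) \<Rightarrow> ('a \<Rightarrow> 'a) \<Rightarrow> ('a \<Rightarrow> 'a) \<Rightarrow> 'a \<Rightarrow> 'a" where
  "curvature nabla X Y Z =
     (\<lambda>P. nabla X (nabla Y Z) P - nabla Y (nabla X Z) P - nabla (lie_bracket X Y) Z P)"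

text \<open>
  The curvature is tensorial, so its value at \<open>P\<close> on tangent vectors \<open>x\<close>, \<open>y\<close>, \<open>z\<close> may be computed
  with any smooth extensions of these; we take the constant ones.
\<close>

definition curvature_at ::
    "(('a::euclidean_space \<Rightarrow> 'a) \<Rightarrow> ('a \<Rightarrow> 'a) \<Rightarrow> ('a \<Rightarrow> 'a)) \<Rightarrow>
     'a \<Rightarrow> 'a \<Rightarrow> 'a \<Rightarrow> 'a \<Rightarrow> 'a" where
  "curvature_at nabla P x y z = curvature nabla (\<lambda>_. x) (\<lambda>_. y) (\<lambda>_. z) P"

definition ricci_symmetric_connection ::
    "(('a::euclidean_space \<Rightarrow> 'a) \<Rightarrow> ('a \<Rightarrow> 'a) \<Rightarrow> ('a \<Rightarrow> 'a)) \<Rightarrow> bool" where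
  "ricci_symmetric_connection nabla \<longleftrightarrow> (\<forall>P. ricci_symmetric (curvature_at nabla P))"

definition ricci_antisymmetric_connection ::
    "(('a::euclidean_space \<Rightarrow> 'a) \<Rightarrow> ('a \<Rightarrow> 'a) \<Rightarrow> ('a \<Rightarrow> 'a)) \<Rightarrow> bool" where
  "ricci_antisymmetric_connection nabla \<longleftrightarrow> (\<forall>P. ricci_antisymmetric (curvature_at nabla P))"

definition ricci_flat_connection ::
    "(('a::euclidean_space \<Rightarrow> 'a) \<Rightarrow> ('a \<Rightarrow> 'a) \<Rightarrow> ('a \<Rightarrow> 'a)) \<Rightarrow> bool" where
  "ricci_flat_connection nabla \<longleftrightarrow> (\<forall>P. ricci_flat (curvature_at nabla P))"

end

theory Submission
  imports Defs
begin

text \<open>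
  All three parts follow from one construction: every generalized algebraic curvature operator \<open>A\<close>
  is the curvature at \<open>0\<close> of a torsion free connection whose Ricci tensor at \<open>u\<close> is
  \<open>(x, y) \<mapsto> ricci A (D\<^sub>u x) (D\<^sub>u y)\<close> for some maps \<open>D\<^sub>u\<close> (\<open>exists_connection_ricci\<close>). Symmetry,
  antisymmetry and vanishing of \<open>ricci A\<close> pass to such a form.

  Near \<open>0\<close> one looks for Christoffel symbols \<open>\<Gamma>\<^sup>k\<^sub>i\<^sub>j\<close> whose Ricci tensor is constant. Its value is
  \<open>\<Sum>\<^sub>k \<partial>\<^sub>k \<Gamma>\<^sup>k\<^sub>i\<^sub>j - \<partial>\<^sub>i \<Sum>\<^sub>k \<Gamma>\<^sup>k\<^sub>k\<^sub>j + \<Sum>\<^sub>k\<^sub>,\<^sub>l (\<Gamma>\<^sup>l\<^sub>l\<^sub>k \<Gamma>\<^sup>k\<^sub>i\<^sub>j - \<Gamma>\<^sup>k\<^sub>i\<^sub>l \<Gamma>\<^sup>l\<^sub>j\<^sub>k)\<close>.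
  The linear symbols \<open>L(P)(x, y) = (A(P,x)y + A(P,y)x) / 3\<close> have curvature \<open>A\<close> at \<open>0\<close>, and the derivative
  terms of their Ricci tensor give the constant \<open>ricci A\<close>. So one needs a correction \<open>C\<close> of order at
  least two whose trace \<open>C\<^sup>k\<^sub>k\<^sub>j\<close> vanishes and whose divergence \<open>\<partial>\<^sub>k C\<^sup>k\<^sub>i\<^sub>j\<close> cancels the quadratic terms of
  \<open>\<Gamma> = L + C\<close>. In dimension at least three every pair \<open>i\<close>, \<open>j\<close> of coordinates leaves a third coordinate
  \<open>k\<close> different from both. If, for each pair, only the component \<open>C\<^sup>k\<^sub>i\<^sub>j\<close> with this \<open>k\<close> is nonzero, the
  trace condition holds automatically, and the divergence condition is an equation for a single
  partial derivative, \<open>\<partial>\<^sub>k C\<^sup>k\<^sub>i\<^sub>j = Q\<^sub>i\<^sub>j(\<Gamma>, \<Gamma>)\<close>, which is solved by integration along one coordinate.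
  Integration does not increase the sum of the absolute values of the coefficients of a polynomial,
  so the recursion for the homogeneous parts of \<open>\<Gamma>\<close> is majorized by a scalar quadratic recursion, and
  the power series converges on a ball (\<open>analytic_series_christoffel_coeff\<close>,
  \<open>ricci_local_curvature_Basis\<close>).

  The solution of such a quadratic equation can blow up at a finite distance. The connection on the whole space is
  therefore the pullback of the local one under a diffeomorphism from \<open>V\<close> onto a cube inside the ball
  of convergence, namely a rescaled arctangent in every coordinate. It fixes \<open>0\<close> and its
  derivative \<open>D\<^sub>0\<close> is the identity, so the curvature at \<open>0\<close> does not change; at \<open>u\<close> the curvature is
  conjugated by \<open>D\<^sub>u\<close> (\<open>curvature_at_nabla\<close>), which leaves traces alone.
\<close>

section \<open>Calculus of smooth functions\<close>

lemma Ck_SucI: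
  assumes "\<And>P. (f has_derivative f' P) (at P)" "\<And>v. Ck k (\<lambda>P. f' P v)"
  shows "Ck (Suc k) f"
proof -
  have "frechet_derivative f (at P) = f' P" for P
    using frechet_derivative_at[OF assms(1)] by simp
  then show ?thesis using assms by (auto simp: differentiable_def)
qed

lemma Ck_Suc_has_derivative:
  "Ck (Suc k) f \<Longrightarrow> (f has_derivative frechet_derivative f (at P)) (at P)"
  by (simp add: frechet_derivative_works)

lemma Ck_SucD: "Ck (Suc k) f \<Longrightarrow> Ck k f"
proof (induction k arbitrary: f)
  case 0
  then show ?case
    by (auto intro!: differentiable_imp_continuous_on simp: differentiable_on_def
        intro: differentiable_at_withinI)
qed simp

lemma Ck_const [simp]: "Ck k (\<lambda>P. c)"
proof (induction k arbitrary: c)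
  case (Suc k)
  show ?case by (rule Ck_SucI[where f' = "\<lambda>P v. 0"]) (auto simp: Suc)
qed simp

lemma Ck_add: "Ck k f \<Longrightarrow> Ck k g \<Longrightarrow> Ck k (\<lambda>P. f P + g P)"
proof (induction k arbitrary: f g)
  case 0
  then show ?case by (simp add: continuous_on_add continuous_on_scaleR)
next
  case (Suc k)
  show ?case
    by (rule Ck_SucI, rule has_derivative_add[OF Suc.prems[THEN Ck_Suc_has_derivative]])
      (use Suc in auto)
qed

lemma Ck_sum: "(\<And>i. i \<in> I \<Longrightarrow> Ck k (f i)) \<Longrightarrow> Ck k (\<lambda>P. \<Sum>i\<in>I. f i P)"
  by (induction I rule: infinite_finite_induct) (auto intro: Ck_add)

lemma Ck_scaleR: "Ck k f \<Longrightarrow> Ck k g \<Longrightarrow> Ck k (\<lambda>P. f P *\<^sub>R g P)"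
proof (induction k arbitrary: f g)
  case 0
  then show ?case by (simp add: continuous_on_add continuous_on_scaleR)
next
  case (Suc k)
  show ?case
    by (rule Ck_SucI, rule has_derivative_scaleR[OF Suc.prems[THEN Ck_Suc_has_derivative]],
        intro Ck_add Suc.IH)
      (use Suc.prems in \<open>simp_all add: Ck_SucD\<close>)
qed

lemma Ck_linear: "bounded_linear L \<Longrightarrow> Ck k f \<Longrightarrow> Ck k (\<lambda>P. L (f P))"
proof (induction k arbitrary: f)
  case 0
  then show ?case
    using bounded_linear.continuous_on by auto
next
  case (Suc k)
  show ?case
    by (rule Ck_SucI, rule bounded_linear.has_derivative[OF Suc.prems(1)],
        rule Ck_Suc_has_derivative[OF Suc.prems(2)])
      (use Suc in auto)
qed

lemma Ck_id: "Ck k (\<lambda>P. P)"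
  by (cases k) (auto intro!: Ck_SucI[where f' = "\<lambda>P v. v"])

lemma Ck_inverse:
  fixes f :: "'a::euclidean_space \<Rightarrow> real"
  assumes "\<And>P. f P \<noteq> 0"
  shows "Ck k f \<Longrightarrow> Ck k (\<lambda>P. inverse (f P))"
proof (induction k)
  case 0
  then show ?case using assms by (simp add: continuous_on_inverse)
next
  case (Suc k)
  (* The derivative of 1 / f is a polynomial in 1 / f and the derivative of f,
    so the induction hypothesis for 1 / f applies. *)
  let ?D = "\<lambda>P v. (- 1) *\<^sub>R (inverse (f P) *\<^sub>R (frechet_derivative f (at P) v *\<^sub>R inverse (f P)))"
  show ?case
  proof (rule Ck_SucI[where f' = ?D])
    show "((\<lambda>P. inverse (f P)) has_derivative ?D P) (at P)" for P
      using Deriv.has_derivative_inverse[OF assms Ck_Suc_has_derivative[OF Suc.prems], of P]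
      by (simp add: mult.assoc)
    show "Ck k (\<lambda>P. ?D P v)" for v
      using Suc Ck_SucD by (intro Ck_scaleR) auto
  qed
qed

lemma smooth_const [simp]: "smooth (\<lambda>P. c)"
  and smooth_id: "smooth (\<lambda>P. P)"
  and smooth_add: "smooth f \<Longrightarrow> smooth g \<Longrightarrow> smooth (\<lambda>P. f P + g P)"
  and smooth_scaleR: "smooth h \<Longrightarrow> smooth g \<Longrightarrow> smooth (\<lambda>P. h P *\<^sub>R g P)"
  and smooth_linear: "bounded_linear L \<Longrightarrow> smooth g \<Longrightarrow> smooth (\<lambda>P. L (g P))"
  and smooth_inverse: "(\<And>P. h P \<noteq> 0) \<Longrightarrow> smooth h \<Longrightarrow> smooth (\<lambda>P. inverse (h P))"
  by (simp_all add: smooth_def Ck_id Ck_add Ck_scaleR Ck_linear Ck_inverse)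

lemma smooth_mult:
  fixes f g :: "'a::euclidean_space \<Rightarrow> real"
  shows "smooth f \<Longrightarrow> smooth g \<Longrightarrow> smooth (\<lambda>P. f P * g P)"
  using smooth_scaleR[of f g] by simp

lemma smooth_inner: "smooth f \<Longrightarrow> smooth (\<lambda>P. f P \<bullet> b)"
  by (rule smooth_linear[OF bounded_linear_inner_left])

lemma smooth_sum: "(\<And>i. i \<in> I \<Longrightarrow> smooth (f i)) \<Longrightarrow> smooth (\<lambda>P. \<Sum>i\<in>I. f i P)"
  by (induction I rule: infinite_finite_induct) (auto intro: smooth_add)

lemmas smooth_intros = smooth_const smooth_id smooth_add smooth_scaleR smooth_mult smooth_inner
  smooth_sum

lemma smooth_has_derivative:
  "smooth f \<Longrightarrow> (f has_derivative frechet_derivative f (at P)) (at P)"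
  unfolding smooth_def using Ck_Suc_has_derivative by blast

lemma smooth_if_smooth_derivative:
  assumes "\<And>P. (f has_derivative f' P) (at P)" "\<And>v. smooth (\<lambda>P. f' P v)"
  shows "smooth f"
  unfolding smooth_def
proof
  fix k
  have "Ck (Suc k) f" by (rule Ck_SucI) (use assms smooth_def in auto)
  then show "Ck k f" by (rule Ck_SucD)
qed

lemma smooth_frechet_derivative:
  assumes "smooth f"
  shows "smooth (\<lambda>P. frechet_derivative f (at P) v)"
  unfolding smooth_def
proof
  fix k
  have "Ck (Suc k) f" using assms by (simp only: smooth_def)
  then show "Ck k (\<lambda>P. frechet_derivative f (at P) v)" by simp
qed

lemma linear_eq_sum_Basis:
  fixes L :: "'a::euclidean_space \<Rightarrow> 'b::real_vector"
  assumes "linear L"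
  shows "L v = (\<Sum>b\<in>Basis. (v \<bullet> b) *\<^sub>R L b)"
  using arg_cong[OF euclidean_representation[of v, symmetric], of L] assms
  by (simp add: linear_sum linear_scale)

lemma smooth_dir_deriv:
  assumes "smooth X" "smooth f"
  shows "smooth (dir_deriv X f)"
proof -
  have "linear (frechet_derivative f (at P))" for P
    using smooth_has_derivative[OF assms(2)] has_derivative_linear by blast
  then have "dir_deriv X f = (\<lambda>P. \<Sum>b\<in>Basis. (X P \<bullet> b) *\<^sub>R frechet_derivative f (at P) b)"
    by (simp add: dir_deriv_def fun_eq_iff flip: linear_eq_sum_Basis)
  then show ?thesis
    using assms by (auto intro!: smooth_intros smooth_frechet_derivative)
qed

text \<open>
  The product rule for \<open>u \<mapsto> T\<^sub>u (W\<^sub>u)\<close> that needs only the pointwise derivatives of \<open>u \<mapsto> T\<^sub>u w\<close>. In finite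
  dimension it follows by expanding \<open>W\<^sub>u\<close> in the basis, so no derivative in an operator norm is required.
\<close>

lemma has_derivative_linear_family:
  fixes T :: "'a::euclidean_space \<Rightarrow> 'b::euclidean_space \<Rightarrow> 'c::real_normed_vector"
  assumes lin: "\<And>u. linear (T u)"
    and T: "\<And>w. ((\<lambda>u. T u w) has_derivative (\<lambda>x. T' x w)) (at u)"
    and W: "(W has_derivative W') (at u)"
  shows "((\<lambda>u. T u (W u)) has_derivative (\<lambda>x. T' x (W u) + T u (W' x))) (at u)"
proof -
  note expand = linear_eq_sum_Basis[OF lin, symmetric]
  have "((\<lambda>v. \<Sum>b\<in>Basis. (w \<bullet> b) *\<^sub>R T v b) has_derivative
      (\<lambda>x. \<Sum>b\<in>Basis. (w \<bullet> b) *\<^sub>R T' x b)) (at u)" for w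
    by (intro derivative_intros T)
  then have "((\<lambda>v. T v w) has_derivative (\<lambda>x. \<Sum>b\<in>Basis. (w \<bullet> b) *\<^sub>R T' x b)) (at u)" for w
    by (simp only: expand)
  then have T'_expand: "(\<Sum>b\<in>Basis. (w \<bullet> b) *\<^sub>R T' x b) = T' x w" for x w
    using fun_cong[OF has_derivative_unique[OF T]] by metis
  have "((\<lambda>v. \<Sum>b\<in>Basis. (W v \<bullet> b) *\<^sub>R T v b) has_derivative
      (\<lambda>x. \<Sum>b\<in>Basis. (W u \<bullet> b) *\<^sub>R T' x b + (W' x \<bullet> b) *\<^sub>R T u b)) (at u)"
    by (intro derivative_intros T W)
  then show ?thesis
    by (simp only: sum.distrib expand T'_expand)
qed

section \<open>Connections given by a frame and a Christoffel tensor\<close>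

text \<open>
  The connection \<open>\<nabla>\<^sub>X Y = D\<^sup>-\<^sup>1(d(D Y)(X) + G(D X, D Y))\<close>, with \<open>E = D\<^sup>-\<^sup>1\<close>. If \<open>D\<close> is the derivative of a map \<open>\<phi>\<close>,
  then this is the pullback under \<open>\<phi>\<close> of the connection with Christoffel tensor \<open>G\<close>. Working with the
  vector field \<open>D Y\<close> in place of \<open>Y\<close> keeps the derivatives of \<open>D\<^sup>-\<^sup>1\<close> out of all computations. The last
  two axioms record that \<open>D\<close> is closed, as a one-form with values in \<open>V\<close>, and that the second
  derivatives of \<open>u \<mapsto> D\<^sub>u z\<close> are symmetric.
\<close>

locale frame_connection =
  fixes D E :: "'a::euclidean_space \<Rightarrow> 'a \<Rightarrow> 'a" and G :: "'a \<Rightarrow> 'a \<Rightarrow> 'a \<Rightarrow> 'a"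
  assumes linear_D: "linear (D u)" and linear_E: "linear (E u)"
    and D_E [simp]: "D u (E u v) = v" and E_D [simp]: "E u (D u v) = v"
    and smooth_D: "smooth X \<Longrightarrow> smooth (\<lambda>u. D u (X u))"
    and smooth_E: "smooth X \<Longrightarrow> smooth (\<lambda>u. E u (X u))"
    and linear_G_left: "linear (\<lambda>v. G u v w)" and linear_G_right: "linear (G u v)"
    and G_sym: "G u v w = G u w v"
    and smooth_G: "smooth X \<Longrightarrow> smooth Y \<Longrightarrow> smooth (\<lambda>u. G u (X u) (Y u))"
    and D_closed: "frechet_derivative (\<lambda>u. D u y) (at u) x = frechet_derivative (\<lambda>u. D u x) (at u) y"
    and D_second_sym:
      "frechet_derivative (\<lambda>u. frechet_derivative (\<lambda>u. D u z) (at u) y) (at u) x =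
       frechet_derivative (\<lambda>u. frechet_derivative (\<lambda>u. D u z) (at u) x) (at u) y"
begin

definition cov :: "('a \<Rightarrow> 'a) \<Rightarrow> ('a \<Rightarrow> 'a) \<Rightarrow> 'a \<Rightarrow> 'a" where
  "cov X Y u = E u (dir_deriv X (\<lambda>u. D u (Y u)) u + G u (D u (X u)) (D u (Y u)))"

abbreviation dD :: "'a \<Rightarrow> 'a \<Rightarrow> 'a \<Rightarrow> 'a" where
  "dD u x z \<equiv> frechet_derivative (\<lambda>u. D u z) (at u) x"

abbreviation dG :: "'a \<Rightarrow> 'a \<Rightarrow> 'a \<Rightarrow> 'a \<Rightarrow> 'a" where
  "dG u x v w \<equiv> frechet_derivative (\<lambda>u. G u v w) (at u) x"

lemma has_derivative_D:
  assumes "smooth Y"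
  shows "((\<lambda>u. D u (Y u)) has_derivative
    (\<lambda>x. dD u x (Y u) + D u (frechet_derivative Y (at u) x))) (at u)"
  by (rule has_derivative_linear_family[where T = D,
        OF linear_D smooth_has_derivative[OF smooth_D[OF smooth_const]] smooth_has_derivative[OF assms]])

lemma frechet_derivative_D:
  "smooth Y \<Longrightarrow> frechet_derivative (\<lambda>u. D u (Y u)) (at u) x =
    dD u x (Y u) + D u (frechet_derivative Y (at u) x)"
  by (rule fun_cong[OF frechet_derivative_at[OF has_derivative_D, symmetric]])

lemma has_derivative_G:
  assumes "smooth V" "smooth W"
  shows "((\<lambda>u. G u (V u) (W u)) has_derivative
    (\<lambda>x. dG u x (V u) (W u) + G u (frechet_derivative V (at u) x) (W u)
        + G u (V u) (frechet_derivative W (at u) x))) (at u)"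
proof (rule has_derivative_linear_family[OF linear_G_right _ smooth_has_derivative[OF assms(2)]])
  show "((\<lambda>u. G u (V u) w) has_derivative
      (\<lambda>x. dG u x (V u) w + G u (frechet_derivative V (at u) x) w)) (at u)" for w
    by (rule has_derivative_linear_family[where T = "\<lambda>u v. G u v w", OF linear_G_left
          smooth_has_derivative[OF smooth_G[OF smooth_const smooth_const]]
          smooth_has_derivative[OF assms(1)]])
qed

lemma linear_frechet: "smooth f \<Longrightarrow> linear (frechet_derivative f (at u))"
  using smooth_has_derivative has_derivative_linear by blast

sublocale torsion_free_connection cov
proof
  fix X X' Y Y' :: "'a \<Rightarrow> 'a" and f :: "'a \<Rightarrow> real"
  assume X: "smooth X" and Y: "smooth Y"
  note DY = smooth_D[OF Y]
  show "smooth (cov X Y)"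
    unfolding cov_def using X Y
    by (intro smooth_E smooth_add smooth_dir_deriv smooth_G smooth_D)
  show "cov (\<lambda>P. X P + X' P) Y = (\<lambda>P. cov X Y P + cov X' Y P)"
    by (simp add: cov_def dir_deriv_def fun_eq_iff linear_add[OF linear_frechet[OF DY]]
        linear_add[OF linear_D] linear_add[OF linear_G_left] linear_add[OF linear_E])
  show "cov (\<lambda>P. f P *\<^sub>R X P) Y = (\<lambda>P. f P *\<^sub>R cov X Y P)"
    by (rule ext) (simp only: cov_def dir_deriv_def linear_scale[OF linear_frechet[OF DY]]
        linear_scale[OF linear_D] linear_scale[OF linear_G_left] linear_scale[OF linear_E]
        flip: scaleR_add_right)
  show "(\<lambda>P. cov X Y P - cov Y X P) = lie_bracket X Y"
  proof
    fix u
    let ?X' = "frechet_derivative X (at u) (Y u)" and ?Y' = "frechet_derivative Y (at u) (X u)"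
    have "cov X Y u - cov Y X u = E u (D u ?Y' - D u ?X')"
      unfolding cov_def dir_deriv_def frechet_derivative_D[OF X] frechet_derivative_D[OF Y]
        D_closed[of "Y u" u "X u"] G_sym[of u "D u (Y u)" "D u (X u)"]
      by (simp only: linear_diff[OF linear_E, symmetric] add_diff_cancel_right add_diff_cancel_left)
    then show "cov X Y u - cov Y X u = lie_bracket X Y u"
      by (simp add: linear_diff[OF linear_E] lie_bracket_def dir_deriv_def)
  qed
  show "cov X (\<lambda>P. f P *\<^sub>R Y P) = (\<lambda>P. dir_deriv X f P *\<^sub>R Y P + f P *\<^sub>R cov X Y P)"
    if f: "smooth f"
  proof
    fix u
    have "((\<lambda>u. f u *\<^sub>R D u (Y u)) has_derivative
        (\<lambda>x. f u *\<^sub>R frechet_derivative (\<lambda>u. D u (Y u)) (at u) x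
          + frechet_derivative f (at u) x *\<^sub>R D u (Y u))) (at u)"
      by (rule has_derivative_scaleR[OF smooth_has_derivative[OF f] smooth_has_derivative[OF DY]])
    from frechet_derivative_at[OF this, symmetric]
    show "cov X (\<lambda>P. f P *\<^sub>R Y P) u = dir_deriv X f u *\<^sub>R Y u + f u *\<^sub>R cov X Y u"
      by (simp add: cov_def dir_deriv_def linear_scale[OF linear_D] linear_scale[OF linear_G_right]
          linear_scale[OF linear_E] linear_add[OF linear_E] scaleR_add_right)
  qed
  show "cov X (\<lambda>P. Y P + Y' P) = (\<lambda>P. cov X Y P + cov X Y' P)" if Y': "smooth Y'"
  proof
    fix u
    have "((\<lambda>u. D u (Y u) + D u (Y' u)) has_derivative
        (\<lambda>x. frechet_derivative (\<lambda>u. D u (Y u)) (at u) x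
          + frechet_derivative (\<lambda>u. D u (Y' u)) (at u) x)) (at u)"
      by (rule has_derivative_add[OF smooth_has_derivative[OF DY]
            smooth_has_derivative[OF smooth_D[OF Y']]])
    from frechet_derivative_at[OF this, symmetric]
    show "cov X (\<lambda>P. Y P + Y' P) u = cov X Y u + cov X Y' u"
      by (simp add: cov_def dir_deriv_def linear_add[OF linear_D] linear_add[OF linear_G_right]
          linear_add[OF linear_E])
  qed
qed

text \<open>
  The terms with a derivative of \<open>D\<close> drop out when \<open>x\<close> and \<open>y\<close> are exchanged and subtracted: the
  second derivatives of \<open>D z\<close> are symmetric, the two mixed terms \<open>G(D y, d\<^sub>xD z)\<close> and \<open>G(D x, d\<^sub>yD z)\<close> occur in
  both orders, and \<open>G(d\<^sub>xD y, D z)\<close> is symmetric because \<open>D\<close> is closed.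
\<close>

lemma curvature_at_cov:
  "curvature_at cov u x y z =
    E u (dG u x (D u y) (D u z) - dG u y (D u x) (D u z)
      + G u (D u x) (G u (D u y) (D u z)) - G u (D u y) (G u (D u x) (D u z)))"
proof -
  let ?d2 = "\<lambda>x y. frechet_derivative (\<lambda>u. frechet_derivative (\<lambda>u. D u z) (at u) y) (at u) x"
  have cov_cov: "cov (\<lambda>_. x) (cov (\<lambda>_. y) (\<lambda>_. z)) u =
      E u (?d2 x y + (dG u x (D u y) (D u z) + G u (dD u x y) (D u z) + G u (D u y) (dD u x z))
        + G u (D u x) (dD u y z + G u (D u y) (D u z)))" for x y
  proof -
    have "((\<lambda>u. dD u y z + G u (D u y) (D u z)) has_derivative (\<lambda>x. ?d2 x y +
        (dG u x (D u y) (D u z) + G u (dD u x y) (D u z) + G u (D u y) (dD u x z)))) (at u)"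
      by (intro has_derivative_add has_derivative_G smooth_has_derivative smooth_frechet_derivative
          smooth_D smooth_const)
    from frechet_derivative_at[OF this, symmetric]
    show ?thesis by (simp add: cov_def dir_deriv_def)
  qed
  have cancel: "(s + (a + b + c) + (d + e)) - (s + (a' + b + d) + (c + e')) = a - a' + e - e'"
    for s a b c d e a' e' :: 'a
    by (simp add: algebra_simps)
  have zero: "frechet_derivative (\<lambda>_. c) (at u) v = 0" for c v u :: 'a
    by (rule fun_cong[OF frechet_derivative_at[OF has_derivative_const, symmetric]])
  have "lie_bracket (\<lambda>_. x) (\<lambda>_. y) = (\<lambda>_. 0)"
    by (simp add: lie_bracket_def dir_deriv_def zero)
  moreover have "cov (\<lambda>_. 0) (\<lambda>_. z) u = 0"
    using linear_frechet[OF smooth_D[OF smooth_const], THEN linear_0]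
    by (simp add: cov_def dir_deriv_def linear_0[OF linear_D] linear_0[OF linear_G_left]
        linear_0[OF linear_E])
  ultimately have "curvature_at cov u x y z =
      cov (\<lambda>_. x) (cov (\<lambda>_. y) (\<lambda>_. z)) u - cov (\<lambda>_. y) (cov (\<lambda>_. x) (\<lambda>_. z)) u"
    by (simp add: curvature_at_def curvature_def)
  also have "\<dots> = E u (dG u x (D u y) (D u z) - dG u y (D u x) (D u z)
      + G u (D u x) (G u (D u y) (D u z)) - G u (D u y) (G u (D u x) (D u z)))"
    unfolding cov_cov linear_diff[OF linear_E, symmetric] linear_add[OF linear_G_right]
      D_second_sym[of z y u x] D_closed[of x u y]
    by (rule arg_cong[of _ _ "E u"], rule cancel)
  finally show ?thesis .
qed

end

section \<open>Homogeneous polynomials\<close>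

definition monomial :: "'a::euclidean_space list \<Rightarrow> 'a \<Rightarrow> real" where
  "monomial xs P = (\<Prod>x\<leftarrow>xs. P \<bullet> x)"

lemma monomial_simps [simp]: "monomial [] P = 1" "monomial (x # xs) P = (P \<bullet> x) * monomial xs P"
  by (simp_all add: monomial_def)

lemma monomial_append: "monomial (xs @ ys) P = monomial xs P * monomial ys P"
  by (simp add: monomial_def)

lemma abs_monomial_le: "set xs \<subseteq> Basis \<Longrightarrow> \<bar>monomial xs P\<bar> \<le> norm P ^ length xs"
  by (induction xs) (auto simp: abs_mult Basis_le_norm intro!: mult_mono)

text \<open>
  \<open>hpoly d c f\<close> says that \<open>f\<close> is a homogeneous polynomial of degree \<open>d\<close> in the coordinates for which the
  absolute values of the coefficients have sum at most \<open>c\<close>. This norm is submultiplicative, bounds the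
  values, and is controlled under differentiation and integration, which is all that a majorant
  argument needs.
\<close>

inductive hpoly :: "nat \<Rightarrow> real \<Rightarrow> ('a::euclidean_space \<Rightarrow> real) \<Rightarrow> bool" where
  monomial: "length xs = d \<Longrightarrow> set xs \<subseteq> Basis \<Longrightarrow> \<bar>a\<bar> \<le> c \<Longrightarrow> hpoly d c (\<lambda>P. a * monomial xs P)"
| add: "hpoly d c f \<Longrightarrow> hpoly d c' g \<Longrightarrow> hpoly d (c + c') (\<lambda>P. f P + g P)"

lemma hpoly_nonneg: "hpoly d c f \<Longrightarrow> 0 \<le> c"
  by (induction rule: hpoly.induct) auto

lemma hpoly_zero: "0 \<le> c \<Longrightarrow> hpoly d c (\<lambda>P::'a::euclidean_space. 0)"
proof -
  assume c: "0 \<le> c"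
  obtain b :: 'a where "b \<in> Basis" using nonempty_Basis by blast
  then have "set (replicate d b) \<subseteq> Basis" by auto
  then show ?thesis using monomial[of "replicate d b" d 0 c] c by simp
qed

lemma hpoly_mono: "hpoly d c f \<Longrightarrow> c \<le> c' \<Longrightarrow> hpoly d c' f"
  using add[OF _ hpoly_zero[of "c' - c" d], of c f] by simp

lemma hpoly_scale: "hpoly d c f \<Longrightarrow> hpoly d (\<bar>s\<bar> * c) (\<lambda>P. s * f P)"
proof (induction rule: hpoly.induct)
  case (monomial xs d a c)
  then show ?case
    using hpoly.monomial[of xs d "s * a" "\<bar>s\<bar> * c"]
    by (simp add: abs_mult mult_left_mono mult.assoc)
next
  case (add d c f c' g)
  then show ?case using hpoly.add[OF add.IH] by (simp add: algebra_simps)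
qed

lemma hpoly_sum:
  "(\<And>i. i \<in> I \<Longrightarrow> hpoly d (c i) (f i)) \<Longrightarrow> hpoly d (\<Sum>i\<in>I. c i) (\<lambda>P. \<Sum>i\<in>I. f i P)"
  by (induction I rule: infinite_finite_induct) (auto intro: hpoly_zero hpoly.add)

lemma hpoly_monomial_mult:
  "hpoly d c f \<Longrightarrow> set xs \<subseteq> Basis \<Longrightarrow> hpoly (length xs + d) (\<bar>a\<bar> * c) (\<lambda>P. (a * monomial xs P) * f P)"
proof (induction rule: hpoly.induct)
  case (monomial ys d b c)
  have "\<bar>a * b\<bar> \<le> \<bar>a\<bar> * c"
    using monomial(3) by (simp add: abs_mult mult_left_mono)
  with monomial have "hpoly (length xs + d) (\<bar>a\<bar> * c) (\<lambda>P. (a * b) * monomial (xs @ ys) P)"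
    by (intro hpoly.monomial) auto
  then show ?case by (simp add: monomial_append mult_ac)
next
  case (add d c f c' g)
  then show ?case using hpoly.add[OF add.IH] by (simp add: algebra_simps)
qed

lemma hpoly_mult: "hpoly d c f \<Longrightarrow> hpoly e c' g \<Longrightarrow> hpoly (d + e) (c * c') (\<lambda>P. f P * g P)"
proof (induction rule: hpoly.induct)
  case (monomial xs d a c)
  then have "hpoly (d + e) (\<bar>a\<bar> * c') (\<lambda>P. (a * monomial xs P) * g P)"
    using hpoly_monomial_mult[of e c' g xs a] by simp
  then show ?case
    using monomial hpoly_nonneg[of e c' g] by (auto elim!: hpoly_mono intro: mult_right_mono)
next
  case (add d c f c' g)
  then show ?case using hpoly.add by (fastforce simp: algebra_simps)
qed

lemma hpoly_bound: "hpoly d c f \<Longrightarrow> \<bar>f P\<bar> \<le> c * norm P ^ d"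
proof (induction rule: hpoly.induct)
  case (monomial xs d a c)
  then show ?case using abs_monomial_le[of xs P] by (auto simp: abs_mult intro!: mult_mono)
next
  case (add d c f c' g)
  then show ?case by (simp add: algebra_simps)
qed

lemma hpoly_at_0: "hpoly (Suc d) c f \<Longrightarrow> f 0 = 0"
  using hpoly_bound[of "Suc d" c f 0] by simp

fun monomial_partial :: "'a::euclidean_space \<Rightarrow> 'a list \<Rightarrow> 'a \<Rightarrow> real" where
  "monomial_partial b [] P = 0"
| "monomial_partial b (x # xs) P = (if x = b then monomial xs P else 0) + (P \<bullet> x) * monomial_partial b xs P"

lemma monomial_has_derivative:
  assumes "set xs \<subseteq> Basis"
  shows "(monomial xs has_derivative (\<lambda>v. \<Sum>b\<in>Basis. (v \<bullet> b) * monomial_partial b xs P)) (at P)"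
  using assms
proof (induction xs)
  case Nil
  have "monomial ([]::'a list) = (\<lambda>_. 1)" by (simp add: fun_eq_iff)
  then show ?case by simp
next
  case (Cons x xs)
  have eq: "monomial (x # xs) = (\<lambda>P. (P \<bullet> x) * monomial xs P)" by (simp add: fun_eq_iff)
  have "((\<lambda>P. (P \<bullet> x) * monomial xs P) has_derivative
    (\<lambda>v. (P \<bullet> x) * (\<Sum>b\<in>Basis. (v \<bullet> b) * monomial_partial b xs P) + (v \<bullet> x) * monomial xs P)) (at P)"
    using Cons by (intro derivative_intros) auto
  moreover have "(\<Sum>b\<in>Basis. (v \<bullet> b) * monomial_partial b (x # xs) P) =
     (P \<bullet> x) * (\<Sum>b\<in>Basis. (v \<bullet> b) * monomial_partial b xs P) + (v \<bullet> x) * monomial xs P" for v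
    using Cons.prems
    by (simp add: distrib_left sum.distrib sum_distrib_left mult_ac if_distrib[of "\<lambda>t. _ * t"]
        cong: if_cong)
  ultimately show ?case by (simp only: eq)
qed

lemma hpoly_monomial_partial:
  "set xs \<subseteq> Basis \<Longrightarrow> hpoly (length xs - 1) (length xs) (monomial_partial b xs)"
proof (induction xs)
  case Nil
  then show ?case using hpoly_zero[of 0 0] by (simp add: fun_eq_iff)
next
  case (Cons x xs)
  have 1: "hpoly (length xs) 1 (\<lambda>P. if x = b then monomial xs P else 0)"
    using Cons.prems monomial[of xs "length xs" 1 1] hpoly_zero[of 1 "length xs"]
    by (cases "x = b") auto
  have 2: "hpoly (length xs) (length xs) (\<lambda>P. (P \<bullet> x) * monomial_partial b xs P)"
  proof (cases "xs = []")
    case True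
    then show ?thesis using hpoly_zero[of 0 0] by simp
  next
    case False
    then have "hpoly (length [x] + (length xs - 1)) (\<bar>1\<bar> * real (length xs))
        (\<lambda>P. (1 * monomial [x] P) * monomial_partial b xs P)"
      using Cons by (intro hpoly_monomial_mult) auto
    then show ?thesis using False by simp
  qed
  show ?case using hpoly.add[OF 1 2] by (simp add: fun_eq_iff add.commute)
qed

text \<open>
  Differentiating a monomial of degree \<open>d\<close> costs at most a factor \<open>d\<close>. For \<open>d = 0\<close> the truncated degree
  \<open>d - 1\<close> is harmless, since the bound \<open>0\<close> then forces the partial derivatives to vanish.
\<close>

lemma hpoly_has_derivative:
  "hpoly d c f \<Longrightarrow> \<exists>g. (\<forall>b. hpoly (d - 1) (d * c) (g b)) \<and>
     (\<forall>P. (f has_derivative (\<lambda>v. \<Sum>b\<in>Basis. (v \<bullet> b) * g b P)) (at P))"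
proof (induction rule: hpoly.induct)
  case (monomial xs d a c)
  let ?g = "\<lambda>b P. a * monomial_partial b xs P"
  have "hpoly (d - 1) (\<bar>a\<bar> * d) (?g b)" for b
    using hpoly_scale[OF hpoly_monomial_partial[OF monomial(2)]] monomial(1) by simp
  then have "hpoly (d - 1) (d * c) (?g b)" for b
    by (rule hpoly_mono) (use monomial(3) in \<open>simp add: mult.commute mult_right_mono\<close>)
  moreover have "((\<lambda>P. a * monomial xs P) has_derivative (\<lambda>v. \<Sum>b\<in>Basis. (v \<bullet> b) * ?g b P)) (at P)" for P
    using has_derivative_mult_right[OF monomial_has_derivative[OF monomial(2)], of a]
    by (simp add: sum_distrib_left mult_ac)
  ultimately show ?case by (intro exI[of _ ?g]) simp
next
  case (add d c f c' f')
  then obtain g g' where g: "\<And>b. hpoly (d - 1) (d * c) (g b)" "\<And>b. hpoly (d - 1) (d * c') (g' b)"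
    and g': "\<And>P. (f has_derivative (\<lambda>v. \<Sum>b\<in>Basis. (v \<bullet> b) * g b P)) (at P)"
    "\<And>P. (f' has_derivative (\<lambda>v. \<Sum>b\<in>Basis. (v \<bullet> b) * g' b P)) (at P)"
    by blast
  have "hpoly (d - 1) (d * (c + c')) (\<lambda>P. g b P + g' b P)" for b
    using hpoly.add[OF g] by (simp add: distrib_left)
  moreover have "((\<lambda>P. f P + f' P) has_derivative (\<lambda>v. \<Sum>b\<in>Basis. (v \<bullet> b) * (g b P + g' b P))) (at P)" for P
    using has_derivative_add[OF g'] by (simp add: distrib_left sum.distrib)
  ultimately show ?case by (intro exI[of _ "\<lambda>b P. g b P + g' b P"]) simp
qed

lemma continuous_on_hpoly: "hpoly d c f \<Longrightarrow> continuous_on S f"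
  by (meson continuous_on_eq_continuous_within continuous_within_subset has_derivative_continuous
      hpoly_has_derivative subset_UNIV)

text \<open>
  The integral of \<open>f\<close> along the coordinate \<open>b\<close>, from the hyperplane \<open>P \<bullet> b = 0\<close> to \<open>P\<close>, rescaled to the unit
  interval so that it needs no distinction of signs.
\<close>

definition antideriv :: "'a::euclidean_space \<Rightarrow> ('a \<Rightarrow> real) \<Rightarrow> 'a \<Rightarrow> real" where
  "antideriv b f P = (P \<bullet> b) * integral {0..1} (\<lambda>s. f (P + ((s - 1) * (P \<bullet> b)) *\<^sub>R b))"

lemma antideriv_zero [simp]: "antideriv b (\<lambda>P. 0) = (\<lambda>P. 0)"
  by (simp add: antideriv_def fun_eq_iff)

lemma antideriv_add:
  assumes "continuous_on UNIV f" "continuous_on UNIV g"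
  shows "antideriv b (\<lambda>P. f P + g P) = (\<lambda>P. antideriv b f P + antideriv b g P)"
proof
  fix P
  have int: "(\<lambda>s. f (P + ((s - 1) * (P \<bullet> b)) *\<^sub>R b)) integrable_on {0..1}"
    if "continuous_on UNIV f" for f :: "'a \<Rightarrow> real"
    by (rule integrable_continuous_real, rule continuous_on_compose2[OF that])
      (intro continuous_intros, simp)
  show "antideriv b (\<lambda>P. f P + g P) P = antideriv b f P + antideriv b g P"
    unfolding antideriv_def
    by (subst integral_add[OF assms[THEN int]]) (simp only: distrib_left)
qed

text \<open>
  Along the path of integration a monomial is multiplied by \<open>s\<^sup>n\<close>, where \<open>n\<close> counts the occurrences of
  \<open>b\<close>; its coefficient is therefore divided by \<open>n + 1\<close>, and in particular does not grow.
\<close>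

lemma antideriv_monomial:
  assumes b: "b \<in> Basis" and "set xs \<subseteq> Basis"
  shows "antideriv b (\<lambda>P. a * monomial xs P) = (\<lambda>P. a / (count_list xs b + 1) * monomial (b # xs) P)"
proof
  fix P :: 'a
  have "monomial xs (P + ((s - 1) * (P \<bullet> b)) *\<^sub>R b) = s ^ count_list xs b * monomial xs P" for s
    using assms(2) b
    by (induction xs) (auto simp: inner_add_left inner_Basis algebra_simps)
  moreover have "integral {0..1} (\<lambda>s::real. s ^ n) = 1 / (n + 1)" for n :: nat
  proof -
    have "((\<lambda>s. s ^ Suc n / Suc n) has_real_derivative x ^ n) (at x within {0..1})" for x :: real
      by (rule has_field_derivative_at_within)
        (use DERIV_cdivide[OF DERIV_pow[of "Suc n" x], of "Suc n"] in simp)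
    then have "((\<lambda>s::real. s ^ n) has_integral (1 ^ Suc n / Suc n - 0 ^ Suc n / Suc n)) {0..1}"
      by (intro fundamental_theorem_of_calculus)
        (auto simp flip: has_real_derivative_iff_has_vector_derivative)
    then show ?thesis by (simp add: integral_unique add.commute)
  qed
  ultimately show "antideriv b (\<lambda>P. a * monomial xs P) P = a / (count_list xs b + 1) * monomial (b # xs) P"
    by (simp add: antideriv_def)
qed

lemma hpoly_antideriv:
  assumes "b \<in> Basis"
  shows "hpoly d c f \<Longrightarrow> hpoly (Suc d) c (antideriv b f)"
proof (induction rule: hpoly.induct)
  case (monomial xs d a c)
  have "\<bar>a / (count_list xs b + 1)\<bar> \<le> \<bar>a\<bar> / 1"
    unfolding abs_divide by (rule divide_left_mono) auto
  then show ?case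
    unfolding antideriv_monomial[OF assms monomial(2)]
    using monomial assms by (intro hpoly.monomial) auto
next
  case (add d c f c' g)
  show ?case
    unfolding antideriv_add[OF continuous_on_hpoly[OF add.hyps(1)] continuous_on_hpoly[OF add.hyps(2)]]
    by (rule hpoly.add[OF add.IH])
qed

text \<open>
  Euler's identity for the single variable \<open>b\<close>.
\<close>

lemma monomial_partial_count: "(P \<bullet> b) * monomial_partial b xs P = count_list xs b * monomial xs P"
proof (induction xs)
  case (Cons x xs)
  have "(P \<bullet> b) * monomial_partial b (x # xs) P =
      (if x = b then monomial (x # xs) P else 0) + (P \<bullet> x) * ((P \<bullet> b) * monomial_partial b xs P)"
    by (simp add: distrib_left mult.left_commute)
  also have "\<dots> = count_list (x # xs) b * monomial (x # xs) P"
    unfolding Cons.IH by (simp add: distrib_right)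
  finally show ?case .
qed simp

lemma antideriv_has_derivative:
  assumes b: "b \<in> Basis"
  shows "hpoly d c f \<Longrightarrow> \<exists>F. (antideriv b f has_derivative F) (at P) \<and> F b = f P"
proof (induction rule: hpoly.induct)
  case (monomial xs d a c)
  define n where "n = real (count_list xs b)"
  let ?F = "\<lambda>v. \<Sum>i\<in>Basis. (v \<bullet> i) * monomial_partial i (b # xs) P"
  have "(monomial (b # xs) has_derivative ?F) (at P)"
    using assms monomial by (intro monomial_has_derivative) auto
  then have deriv: "((\<lambda>P. a / (n + 1) * monomial (b # xs) P) has_derivative (\<lambda>v. a / (n + 1) * ?F v)) (at P)"
    by (rule has_derivative_mult_right)
  have "?F b = (n + 1) * monomial xs P"
  proof -
    have "?F b = monomial_partial b (b # xs) P"
      using b by (simp add: inner_Basis if_distrib[of "\<lambda>t. t * _"] cong: if_cong)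
    also have "\<dots> = (n + 1) * monomial xs P"
      by (simp add: monomial_partial_count n_def distrib_right)
    finally show ?thesis .
  qed
  then have at_b: "a / (n + 1) * ?F b = a * monomial xs P"
    by (simp add: n_def del: monomial_partial.simps)
  have eq: "antideriv b (\<lambda>P. a * monomial xs P) = (\<lambda>P. a / (n + 1) * monomial (b # xs) P)"
    unfolding antideriv_monomial[OF assms monomial(2)] n_def by (simp add: add.commute)
  show ?case unfolding eq using deriv at_b by blast
next
  case (add d c f c' g)
  then obtain F F' where "(antideriv b f has_derivative F) (at P)" "F b = f P"
     "(antideriv b g has_derivative F') (at P)" "F' b = g P" by blast
  then show ?case
    unfolding antideriv_add[OF continuous_on_hpoly[OF add.hyps(1)] continuous_on_hpoly[OF add.hyps(2)]]
    by (intro exI[of _ "\<lambda>v. F v + F' v"] conjI has_derivative_add) auto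
qed

section \<open>Power series on a ball\<close>

text \<open>
  The term of index \<open>n\<close> is homogeneous of degree \<open>n\<close>, and the coefficient norms form a power series with
  radius of convergence at least \<open>r\<close>.
\<close>

definition analytic_series :: "real \<Rightarrow> (nat \<Rightarrow> 'a::euclidean_space \<Rightarrow> real) \<Rightarrow> bool" where
  "analytic_series r f \<longleftrightarrow>
    (\<exists>c. (\<forall>n. hpoly n (c n) (f n)) \<and> (\<forall>x. \<bar>x\<bar> < r \<longrightarrow> summable (\<lambda>n. c n * x ^ n)))"

lemma analytic_series_summable:
  assumes "analytic_series r f" "norm P < r"
  shows "summable (\<lambda>n. \<bar>f n P\<bar>)"
proof -
  obtain c where c: "\<And>n. hpoly n (c n) (f n)"
    and summable_c: "\<And>x. \<bar>x\<bar> < r \<Longrightarrow> summable (\<lambda>n. c n * x ^ n)"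
    using assms(1) unfolding analytic_series_def by blast
  show ?thesis
    by (rule summable_comparison_test'[OF summable_c[of "norm P"], of 0])
      (use assms(2) hpoly_bound[OF c] in auto)
qed

text \<open>
  The partial derivatives have coefficient norms \<open>diffs c\<close>, a power series with the same radius of
  convergence, so they are again analytic series. On every smaller ball they converge uniformly by
  the Weierstrass test, which justifies termwise differentiation.
\<close>

lemma analytic_series_has_derivative:
  assumes "analytic_series r f"
  obtains g where "\<And>b. analytic_series r (g b)"
    and "\<And>n P. (f (Suc n) has_derivative (\<lambda>v. \<Sum>b\<in>Basis. (v \<bullet> b) * g b n P)) (at P)"
    and "\<And>P. norm P < r \<Longrightarrow>
      ((\<lambda>P. \<Sum>n. f n P) has_derivative (\<lambda>v. \<Sum>b\<in>Basis. (v \<bullet> b) * (\<Sum>n. g b n P))) (at P)"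
proof -
  obtain c where c: "\<And>n. hpoly n (c n) (f n)"
    and summable_c: "\<And>x. \<bar>x\<bar> < r \<Longrightarrow> summable (\<lambda>n. c n * x ^ n)"
    using assms unfolding analytic_series_def by blast
  have "\<forall>n. \<exists>g. (\<forall>b. hpoly (n - 1) (n * c n) (g b)) \<and>
     (\<forall>P. (f n has_derivative (\<lambda>v. \<Sum>b\<in>Basis. (v \<bullet> b) * g b P)) (at P))"
    using hpoly_has_derivative[OF c] by blast
  from choice[OF this] obtain G where G: "\<And>n b. hpoly (n - 1) (n * c n) (G n b)"
    and f_deriv: "\<And>n P. (f n has_derivative (\<lambda>v. \<Sum>b\<in>Basis. (v \<bullet> b) * G n b P)) (at P)"
    by blast
  define g where "g = (\<lambda>b n. G (Suc n) b)"
  have summable_diffs: "summable (\<lambda>n. diffs c n * x ^ n)" if "\<bar>x\<bar> < r" for x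
    by (rule termdiff_converges[of x r]) (use that summable_c in auto)
  have g: "hpoly n (diffs c n) (g b n)" for b n
    using G[of "Suc n" b] by (simp only: g_def diffs_def diff_Suc_1)
  have analytic_g: "analytic_series r (g b)" for b
    using g summable_diffs by (auto simp: analytic_series_def)
  have G0: "G 0 b P = 0" for b P
    using hpoly_bound[OF G[of 0 b], of P] by simp
  have suminf_G: "(\<Sum>n. G n b P) = (\<Sum>n. g b n P)" if "norm P < r" for b P
  proof -
    have "summable (\<lambda>n. G (Suc n) b P)"
      using analytic_series_summable[OF analytic_g that] by (auto simp: g_def intro: summable_rabs_cancel)
    then have "summable (\<lambda>n. G n b P)"
      by (rule iffD1[OF summable_Suc_iff[of "\<lambda>n. G n b P"]])
    from suminf_split_head[OF this] show ?thesis by (simp add: G0 g_def)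
  qed
  have series: "((\<lambda>P. \<Sum>n. f n P) has_derivative (\<lambda>v. \<Sum>b\<in>Basis. (v \<bullet> b) * (\<Sum>n. G n b P))) (at P)"
    if P: "norm P < r" for P
  proof -
    obtain s where s: "norm P < s" "s < r" using P dense by blast
    then have "0 < s" using norm_ge_zero[of P] by linarith
    define S where "S = ball (0::'a) s"
    have S: "open S" "convex S" "P \<in> S" using s by (auto simp: S_def)
    define M where "M = (\<lambda>n. n * c n * s ^ (n - 1))"
    have "summable (\<lambda>n. M (Suc n))"
      using summable_diffs[of s] s \<open>0 < s\<close> by (simp add: M_def diffs_def)
    then have M: "summable M" by (rule iffD1[OF summable_Suc_iff[of M]])
    have "norm (G n b Q) \<le> M n" if "Q \<in> S" for n b Q
    proof -
      have "\<bar>G n b Q\<bar> \<le> n * c n * norm Q ^ (n - 1)"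
        by (rule hpoly_bound[OF G])
      also have "\<dots> \<le> M n"
        unfolding M_def using that hpoly_nonneg[OF c]
        by (intro mult_left_mono power_mono) (auto simp: S_def)
      finally show ?thesis by simp
    qed
    then have uniform: "uniform_limit S (\<lambda>n Q. \<Sum>i<n. G i b Q) (\<lambda>Q. \<Sum>n. G n b Q) sequentially" for b
      by (rule Weierstrass_m_test[OF _ M])
    have "\<forall>\<^sub>F n in sequentially. \<forall>Q\<in>S. \<forall>v. norm ((\<Sum>i<n. \<Sum>b\<in>Basis. (v \<bullet> b) * G i b Q) -
        (\<Sum>b\<in>Basis. (v \<bullet> b) * (\<Sum>n. G n b Q))) \<le> e * norm v" if "e > 0" for e
    proof -
      have "\<forall>b\<in>(Basis::'a set). \<forall>\<^sub>F n in sequentially.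
          \<forall>Q\<in>S. dist (\<Sum>i<n. G i b Q) (\<Sum>n. G n b Q) < e / DIM('a)"
        using uniform that by (auto intro!: uniform_limitD)
      then have "\<forall>\<^sub>F n in sequentially. \<forall>b\<in>(Basis::'a set).
          \<forall>Q\<in>S. dist (\<Sum>i<n. G i b Q) (\<Sum>n. G n b Q) < e / DIM('a)"
        by (intro eventually_ball_finite) auto
      then show ?thesis
      proof eventually_elim
        case (elim n)
        show ?case
        proof (intro ballI allI)
          fix Q v assume Q: "Q \<in> S"
          have "(\<Sum>i<n. \<Sum>b\<in>Basis. (v \<bullet> b) * G i b Q) - (\<Sum>b\<in>Basis. (v \<bullet> b) * (\<Sum>n. G n b Q))
              = (\<Sum>b\<in>Basis. (v \<bullet> b) * ((\<Sum>i<n. G i b Q) - (\<Sum>n. G n b Q)))"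
            by (subst sum.swap) (simp add: sum_distrib_left right_diff_distrib sum_subtractf)
          also have "norm \<dots> \<le> (\<Sum>b\<in>(Basis::'a set). norm v * (e / DIM('a)))"
          proof (rule sum_norm_le)
            fix b :: 'a assume b: "b \<in> Basis"
            then have "\<bar>(\<Sum>i<n. G i b Q) - (\<Sum>n. G n b Q)\<bar> \<le> e / DIM('a)"
              using elim Q by (fastforce simp: dist_real_def)
            then show "norm ((v \<bullet> b) * ((\<Sum>i<n. G i b Q) - (\<Sum>n. G n b Q))) \<le> norm v * (e / DIM('a))"
              unfolding real_norm_def abs_mult using Basis_le_norm[OF b, of v]
              by (intro mult_mono) auto
          qed
          also have "\<dots> = e * norm v" by simp
          finally show "norm ((\<Sum>i<n. \<Sum>b\<in>Basis. (v \<bullet> b) * G i b Q) -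
              (\<Sum>b\<in>Basis. (v \<bullet> b) * (\<Sum>n. G n b Q))) \<le> e * norm v" .
        qed
      qed
    qed
    moreover have "summable (\<lambda>n. f n P)"
      using analytic_series_summable[OF assms P] by (rule summable_rabs_cancel)
    ultimately have "\<exists>F. \<forall>Q\<in>S. (\<lambda>n. f n Q) sums F Q \<and>
        (F has_derivative (\<lambda>v. \<Sum>b\<in>Basis. (v \<bullet> b) * (\<Sum>n. G n b Q))) (at Q within S)"
      using S(3) by (intro has_derivative_series[OF S(2) has_derivative_at_withinI[OF f_deriv],
            where x = P] summable_sums) auto
    then obtain F where F: "\<And>Q. Q \<in> S \<Longrightarrow> (\<lambda>n. f n Q) sums F Q"
      and F': "(F has_derivative (\<lambda>v. \<Sum>b\<in>Basis. (v \<bullet> b) * (\<Sum>n. G n b P))) (at P within S)"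
      using S(3) by blast
    have "(F has_derivative (\<lambda>v. \<Sum>b\<in>Basis. (v \<bullet> b) * (\<Sum>n. G n b P))) (at P)"
      using F' at_within_open[OF S(3,1)] by simp
    then show ?thesis
      by (rule has_derivative_transform_within_open[OF _ S(1,3)]) (use F sums_unique in blast)
  qed
  have "((\<lambda>P. \<Sum>n. f n P) has_derivative (\<lambda>v. \<Sum>b\<in>Basis. (v \<bullet> b) * (\<Sum>n. g b n P))) (at P)"
    if "norm P < r" for P
    using series[OF that] unfolding suminf_G[OF that] .
  moreover have "(f (Suc n) has_derivative (\<lambda>v. \<Sum>b\<in>Basis. (v \<bullet> b) * g b n P)) (at P)" for n P
    using f_deriv[of "Suc n"] by (simp add: g_def)
  ultimately show thesis using that analytic_g by blast
qed

text \<open>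
  By the chain rule the derivative of the composition is a combination of analytic series composed
  with \<open>\<phi>\<close>, with smooth coefficients; induction on the order of differentiability applies because
  the class of analytic series is closed under partial derivatives.
\<close>

lemma smooth_analytic_series:
  fixes \<phi> :: "'b::euclidean_space \<Rightarrow> 'a::euclidean_space"
  assumes \<phi>: "smooth \<phi>" "\<And>u. norm (\<phi> u) < r"
  shows "analytic_series r f \<Longrightarrow> smooth (\<lambda>u. \<Sum>n. f n (\<phi> u))"
  unfolding smooth_def
proof
  fix k
  have deriv: "\<exists>g. (\<forall>b. analytic_series r (g b)) \<and> (\<forall>u. ((\<lambda>u. \<Sum>n. f n (\<phi> u)) has_derivative
      (\<lambda>v. \<Sum>b\<in>Basis. (frechet_derivative \<phi> (at u) v \<bullet> b) * (\<Sum>n. g b n (\<phi> u)))) (at u))"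
    if "analytic_series r f" for f
  proof -
    show ?thesis
    proof (rule analytic_series_has_derivative[OF \<open>analytic_series r f\<close>])
      fix g :: "'a \<Rightarrow> nat \<Rightarrow> 'a \<Rightarrow> real"
      assume g: "\<And>b. analytic_series r (g b)" and g': "\<And>P. norm P < r \<Longrightarrow>
        ((\<lambda>P. \<Sum>n. f n P) has_derivative (\<lambda>v. \<Sum>b\<in>Basis. (v \<bullet> b) * (\<Sum>n. g b n P))) (at P)"
      show ?thesis
        by (intro exI[of _ g] conjI allI g
            has_derivative_compose[OF smooth_has_derivative[OF \<phi>(1)] g'[OF \<phi>(2)]])
    qed
  qed
  show "analytic_series r f \<Longrightarrow> Ck k (\<lambda>u. \<Sum>n. f n (\<phi> u))"
  proof (induction k arbitrary: f)
    case 0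
    then have "isCont (\<lambda>u. \<Sum>n. f n (\<phi> u)) u" for u
      using deriv has_derivative_continuous by blast
    then show ?case by (simp add: continuous_at_imp_continuous_on)
  next
    case (Suc k)
    obtain g where g: "\<And>b. analytic_series r (g b)"
      and g': "\<And>u. ((\<lambda>u. \<Sum>n. f n (\<phi> u)) has_derivative
        (\<lambda>v. \<Sum>b\<in>Basis. (frechet_derivative \<phi> (at u) v \<bullet> b) * (\<Sum>n. g b n (\<phi> u)))) (at u)"
      using deriv[OF Suc.prems] by blast
    have "Ck k (\<lambda>u. (frechet_derivative \<phi> (at u) v \<bullet> b) *\<^sub>R (\<Sum>n. g b n (\<phi> u)))" for v b
      using smooth_inner[OF smooth_frechet_derivative[OF \<phi>(1)]] Suc.IH[OF g]
      by (intro Ck_scaleR) (auto simp: smooth_def)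
    then show ?case
      by (intro Ck_SucI[OF g'] Ck_sum) simp
  qed
qed

section \<open>The recursion for the Christoffel symbols\<close>

text \<open>
  The coordinate along which the equation for the pair \<open>i\<close>, \<open>j\<close> is integrated. It depends only on the
  set \<open>{i, j}\<close>, which keeps the Christoffel symbols symmetric.
\<close>

definition third_basis :: "'a::euclidean_space \<Rightarrow> 'a \<Rightarrow> 'a" where
  "third_basis i j = (SOME k. k \<in> Basis - {i, j})"

lemma third_basis:
  assumes "3 \<le> DIM('a::euclidean_space)"
  shows "third_basis i j \<in> Basis" "third_basis i j \<noteq> i" "third_basis i (j::'a) \<noteq> j"
proof -
  have "card (Basis - {i, j}) \<ge> card (Basis :: 'a set) - card {i, j}"
    by (rule diff_card_le_card_Diff) simp
  moreover have "card {i, j} \<le> 2" by (simp add: card_insert_le_m1)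
  ultimately have "card (Basis - {i, j}) \<noteq> 0" using assms by linarith
  then have "Basis - {i, j} \<noteq> {}" by (metis card.empty)
  then have "third_basis i j \<in> Basis - {i, j}"
    unfolding third_basis_def using some_in_eq[of "Basis - {i, j}"] by blast
  then show "third_basis i j \<in> Basis" "third_basis i j \<noteq> i" "third_basis i j \<noteq> j" by auto
qed

lemma third_basis_commute: "third_basis i j = third_basis j i"
  by (simp add: third_basis_def insert_commute)

text \<open>
  The scalar version of the recursion for the Christoffel symbols: a linear term of size \<open>M\<close> and a
  quadratic nonlinearity of size \<open>B\<close>.
\<close>

fun majorant :: "real \<Rightarrow> real \<Rightarrow> nat \<Rightarrow> real" where
  "majorant M B 0 = 0"
| "majorant M B (Suc n) =
    (if n = 0 then M else 0) + B * (\<Sum>a\<le>n. majorant M B a * majorant M B (n - a))"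

lemma majorant_nonneg: "0 \<le> M \<Longrightarrow> 0 \<le> B \<Longrightarrow> 0 \<le> majorant M B n"
proof (induction n rule: less_induct)
  case (less n)
  then show ?case
    by (cases n) (auto intro!: add_nonneg_nonneg mult_nonneg_nonneg sum_nonneg)
qed

lemma sum_convolution_le:
  fixes x y :: "nat \<Rightarrow> real"
  assumes "\<And>n. 0 \<le> x n" "\<And>n. 0 \<le> y n"
  shows "(\<Sum>n\<le>N. \<Sum>a\<le>n. x a * y (n - a)) \<le> (\<Sum>n\<le>N. x n) * (\<Sum>n\<le>N. y n)"
proof -
  have "(\<Sum>n\<le>N. \<Sum>a\<le>n. x a * y (n - a)) = (\<Sum>(a, b)\<in>{(a, b). a + b \<le> N}. x a * y b)"
    by (rule sum.triangle_reindex_eq[symmetric])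
  also have "\<dots> \<le> (\<Sum>(a, b)\<in>{..N} \<times> {..N}. x a * y b)"
    using assms by (intro sum_mono2) auto
  also have "\<dots> = (\<Sum>n\<le>N. x n) * (\<Sum>n\<le>N. y n)"
    by (simp add: sum_product sum.cartesian_product)
  finally show ?thesis .
qed

text \<open>
  With \<open>r = 1 / (M + B)\<close> the partial sums \<open>S\<^sub>N\<close> of \<open>majorant M B n * r ^ n\<close> satisfy
  \<open>S\<^sub>N\<^sub>+\<^sub>1 \<le> r (M + B S\<^sub>N\<^sup>2)\<close>, a map that sends \<open>[0, 1]\<close> to itself. So they stay below \<open>1\<close>.
\<close>

lemma majorant_summable:
  assumes "0 \<le> M" "0 < B" "\<bar>x\<bar> < 1 / (M + B)"
  shows "summable (\<lambda>n. majorant M B n * x ^ n)"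
proof -
  (* The rescaled coefficients turn the powers of r into a single factor in the recursion. *)
  define r where "r = 1 / (M + B)"
  define c where "c = (\<lambda>n. majorant M B n * r ^ n)"
  have r: "0 < r" "r * (M + B) = 1" using assms by (auto simp: r_def)
  have c: "0 \<le> c n" for n
    using majorant_nonneg[of M B n] assms r by (simp add: c_def)
  have c_Suc: "c (Suc n) = r * ((if n = 0 then M else 0) + B * (\<Sum>a\<le>n. c a * c (n - a)))" for n
  proof -
    have "(\<Sum>a\<le>n. c a * c (n - a)) = (\<Sum>a\<le>n. majorant M B a * majorant M B (n - a)) * r ^ n"
      unfolding sum_distrib_right
      by (rule sum.cong) (auto simp: c_def mult_ac simp flip: power_add)
    then show ?thesis by (simp add: c_def algebra_simps)
  qed
  have "(\<Sum>n\<le>N. c n) \<le> 1" for N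
  proof (induction N)
    case 0
    then show ?case by (simp add: c_def)
  next
    case (Suc N)
    have "(\<Sum>n\<le>Suc N. c n) = (\<Sum>n\<le>N. c (Suc n))"
      by (subst sum.atMost_Suc_shift) (simp add: c_def)
    also have "\<dots> = r * (M + B * (\<Sum>n\<le>N. \<Sum>a\<le>n. c a * c (n - a)))"
      unfolding c_Suc by (simp add: sum.distrib flip: sum_distrib_left)
    also have "\<dots> \<le> r * (M + B * ((\<Sum>n\<le>N. c n) * (\<Sum>n\<le>N. c n)))"
      using r assms sum_convolution_le[of c c N] c
      by (intro mult_left_mono add_left_mono) auto
    also have "\<dots> \<le> r * (M + B * (1 * 1))"
      using r assms Suc c by (intro mult_left_mono add_left_mono mult_mono sum_nonneg) auto
    finally show ?case using r by simp
  qed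
  then have "summable c"
    by (rule bounded_imp_summable[OF c])
  then show ?thesis
    using powser_inside[of "majorant M B" r x] assms r by (simp add: c_def r_def)
qed

lemma sum_inner_Basis: "b \<in> Basis \<Longrightarrow> (\<Sum>i\<in>Basis. (b \<bullet> i) * f i) = (f b :: real)"
  by (simp add: inner_Basis if_distrib[of "\<lambda>t. t * _"] cong: if_cong)

text \<open>
  The linear part \<open>L\<close> of the Christoffel tensor to be constructed; \<open>P\<close> in \<open>L P x y\<close> is the point.
\<close>

locale linear_christoffel =
  fixes L :: "'a::euclidean_space \<Rightarrow> 'a \<Rightarrow> 'a \<Rightarrow> 'a"
  assumes dim: "3 \<le> DIM('a)"
    and L_linear: "linear (\<lambda>P. L P x y)"
    and L_linear_right: "linear (L P x)"
    and L_sym: "L P x y = L P y x"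
begin

text \<open>
  \<open>christoffel_coeff n i j k\<close> is the homogeneous part of degree \<open>n\<close> of \<open>\<Gamma>\<^sup>k\<^sub>i\<^sub>j\<close>. The part of degree one is \<open>L\<close>,
  because the quadratic terms of degree \<open>0\<close> vanish. The sums over \<open>a\<close> are the terms of degree \<open>n\<close> of
  \<open>\<Gamma>\<^sup>p\<^sub>i\<^sub>q \<Gamma>\<^sup>q\<^sub>j\<^sub>p - \<Gamma>\<^sup>q\<^sub>q\<^sub>p \<Gamma>\<^sup>p\<^sub>i\<^sub>j\<close>, and integrating them along \<open>third_basis i j\<close> solves the divergence equation.
\<close>

fun christoffel_coeff :: "nat \<Rightarrow> 'a \<Rightarrow> 'a \<Rightarrow> 'a \<Rightarrow> 'a \<Rightarrow> real" where
  "christoffel_coeff 0 i j k = (\<lambda>P. 0)"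
| "christoffel_coeff (Suc n) i j k =
    (\<lambda>P. (if n = 0 then L P i j \<bullet> k else 0) +
      (if k = third_basis i j
       then antideriv k (\<lambda>P. \<Sum>p\<in>Basis. \<Sum>q\<in>Basis.
          (\<Sum>a\<le>n. christoffel_coeff a i q p P * christoffel_coeff (n - a) j p q P) -
          (\<Sum>a\<le>n. christoffel_coeff a q p q P * christoffel_coeff (n - a) i j p P)) P
       else 0))"

definition quad_coeff :: "nat \<Rightarrow> 'a \<Rightarrow> 'a \<Rightarrow> 'a \<Rightarrow> real" where
  "quad_coeff n i j P = (\<Sum>p\<in>Basis. \<Sum>q\<in>Basis.
          (\<Sum>a\<le>n. christoffel_coeff a i q p P * christoffel_coeff (n - a) j p q P) -
          (\<Sum>a\<le>n. christoffel_coeff a q p q P * christoffel_coeff (n - a) i j p P))"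

declare christoffel_coeff.simps(2) [simp del]

lemma christoffel_coeff_Suc:
  "christoffel_coeff (Suc n) i j k =
    (\<lambda>P. (if n = 0 then L P i j \<bullet> k else 0) +
      (if k = third_basis i j then antideriv k (quad_coeff n i j) P else 0))"
  by (simp only: christoffel_coeff.simps(2) quad_coeff_def[abs_def])

text \<open>
  In \<open>\<Gamma>\<^sup>p\<^sub>i\<^sub>q \<Gamma>\<^sup>q\<^sub>j\<^sub>p\<close> exchanging \<open>i\<close> and \<open>j\<close> amounts to exchanging the summation indices \<open>p\<close> and \<open>q\<close> and reversing
  the order of the Cauchy product.
\<close>

lemma christoffel_coeff_sym: "christoffel_coeff n i j = christoffel_coeff n j i"
proof (induction n arbitrary: i j rule: less_induct)
  case (less n)
  show ?case
  proof (cases n)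
    case (Suc m)
    have "quad_coeff m i j P = quad_coeff m j i P" for P
    proof -
      have "(\<Sum>p\<in>Basis. \<Sum>q\<in>Basis. \<Sum>a\<le>m. christoffel_coeff a i q p P * christoffel_coeff (m - a) j p q P) =
        (\<Sum>p\<in>Basis. \<Sum>q\<in>Basis. \<Sum>a\<le>m. christoffel_coeff a j q p P * christoffel_coeff (m - a) i p q P)"
      proof (subst sum.swap, rule sum.cong[OF refl], rule sum.cong[OF refl])
        fix p q :: 'a
        show "(\<Sum>a\<le>m. christoffel_coeff a i p q P * christoffel_coeff (m - a) j q p P) =
            (\<Sum>a\<le>m. christoffel_coeff a j q p P * christoffel_coeff (m - a) i p q P)"
          by (subst sum.nat_diff_reindex[symmetric, of _ "Suc m", unfolded lessThan_Suc_atMost])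
            (auto intro!: sum.cong)
      qed
      moreover have "christoffel_coeff (m - a) i j = christoffel_coeff (m - a) j i" for a
        using less.IH[of "m - a" i j] Suc by simp
      ultimately show ?thesis by (simp add: quad_coeff_def sum_subtractf)
    qed
    then have "quad_coeff m i j = quad_coeff m j i" by blast
    then show ?thesis
      unfolding Suc by (intro ext) (simp add: christoffel_coeff_Suc L_sym[of _ i j] third_basis_commute[of i j])
  qed (simp add: fun_eq_iff)
qed

definition L_norm :: real where
  "L_norm = (\<Sum>i\<in>Basis. \<Sum>j\<in>Basis. \<Sum>k\<in>Basis. \<Sum>b\<in>Basis. \<bar>L b i j \<bullet> k\<bar>)"

text \<open>
  The number of products in \<open>quad_coeff\<close>: two for each pair of basis vectors.
\<close>

definition quad_norm :: real where
  "quad_norm = (\<Sum>p\<in>(Basis::'a set). \<Sum>q\<in>(Basis::'a set). 2)"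

definition radius :: real where
  "radius = 1 / (L_norm + quad_norm)"

lemma L_norm_nonneg: "0 \<le> L_norm"
  by (simp add: L_norm_def sum_nonneg)

lemma quad_norm_pos: "0 < quad_norm"
  by (simp add: quad_norm_def)

lemma radius_pos: "0 < radius"
  using L_norm_nonneg quad_norm_pos by (simp add: radius_def)

lemma hpoly_L:
  assumes "i \<in> Basis" "j \<in> Basis" "k \<in> Basis"
  shows "hpoly (Suc 0) L_norm (\<lambda>P. L P i j \<bullet> k)"
proof -
  have "hpoly (Suc 0) (\<Sum>b\<in>Basis. \<bar>L b i j \<bullet> k\<bar>) (\<lambda>P. \<Sum>b\<in>Basis. (L b i j \<bullet> k) * monomial [b] P)"
    by (intro hpoly_sum hpoly.monomial) auto
  moreover have "(\<Sum>b\<in>Basis. (L b i j \<bullet> k) * monomial [b] P) = L P i j \<bullet> k" for P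
    by (subst (2) linear_eq_sum_Basis[OF L_linear]) (simp add: inner_sum_left mult.commute)
  ultimately have "hpoly (Suc 0) (\<Sum>b\<in>Basis. \<bar>L b i j \<bullet> k\<bar>) (\<lambda>P. L P i j \<bullet> k)" by simp
  moreover have "(\<Sum>b\<in>Basis. \<bar>L b i j \<bullet> k\<bar>) \<le> L_norm"
  proof -
    have "(\<Sum>b\<in>Basis. \<bar>L b i j \<bullet> k\<bar>) \<le> (\<Sum>k\<in>Basis. \<Sum>b\<in>Basis. \<bar>L b i j \<bullet> k\<bar>)"
      using assms(3) by (intro member_le_sum) (auto intro: sum_nonneg)
    also have "\<dots> \<le> (\<Sum>j\<in>Basis. \<Sum>k\<in>Basis. \<Sum>b\<in>Basis. \<bar>L b i j \<bullet> k\<bar>)"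
      using assms(2) by (intro member_le_sum[of j]) (auto intro!: sum_nonneg)
    also have "\<dots> \<le> L_norm"
      unfolding L_norm_def using assms(1) by (intro member_le_sum[of i]) (auto intro!: sum_nonneg)
    finally show ?thesis .
  qed
  ultimately show ?thesis by (rule hpoly_mono)
qed

abbreviation maj :: "nat \<Rightarrow> real" where
  "maj \<equiv> majorant L_norm quad_norm"

text \<open>
  The bound for \<open>quad_coeff\<close> in degree \<open>n\<close> uses the Christoffel symbols up to degree \<open>n\<close>, and the bound for
  the latter in degree \<open>n + 1\<close> uses the former in degree \<open>n\<close>; the two are proved together.
\<close>

lemma hpoly_christoffel_coeff_quad_coeff:
  "i \<in> Basis \<Longrightarrow> j \<in> Basis \<Longrightarrow> k \<in> Basis \<Longrightarrow> hpoly n (maj n) (christoffel_coeff n i j k)"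
  "i \<in> Basis \<Longrightarrow> j \<in> Basis \<Longrightarrow>
    hpoly n (quad_norm * (\<Sum>a\<le>n. maj a * maj (n - a))) (quad_coeff n i j)"
proof -
  have quad: "hpoly n (quad_norm * (\<Sum>a\<le>n. maj a * maj (n - a))) (quad_coeff n i j)"
    if IH: "\<And>m i j k. m \<le> n \<Longrightarrow> i \<in> Basis \<Longrightarrow> j \<in> Basis \<Longrightarrow> k \<in> Basis \<Longrightarrow> hpoly m (maj m) (christoffel_coeff m i j k)"
      and "i \<in> Basis" "j \<in> Basis" for n i j
  proof -
    have prod: "hpoly n (\<Sum>a\<le>n. maj a * maj (n - a)) (\<lambda>P. \<Sum>a\<le>n. christoffel_coeff a i j k P * christoffel_coeff (n - a) i' j' k' P)"
      if "i \<in> Basis" "j \<in> Basis" "k \<in> Basis" "i' \<in> Basis" "j' \<in> Basis" "k' \<in> Basis" for i j k i' j' k'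
    proof (rule hpoly_sum)
      fix a assume "a \<in> {..n}"
      then show "hpoly n (maj a * maj (n - a)) (\<lambda>P. christoffel_coeff a i j k P * christoffel_coeff (n - a) i' j' k' P)"
        using hpoly_mult[OF IH[of a i j k] IH[of "n - a" i' j' k']] that by simp
    qed
    have diff: "hpoly n (2 * c) (\<lambda>P. f P - g P)" if "hpoly n c f" "hpoly n c g"
      for c :: real and f g :: "'a \<Rightarrow> real"
      using hpoly.add[OF that(1) hpoly_scale[OF that(2), of "-1"]] by simp
    have "hpoly n (\<Sum>p\<in>(Basis::'a set). \<Sum>q\<in>(Basis::'a set). 2 * (\<Sum>a\<le>n. maj a * maj (n - a)))
        (quad_coeff n i j)"
      unfolding quad_coeff_def[abs_def] using that(2,3) by (intro hpoly_sum diff prod)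
    then show ?thesis by (simp add: quad_norm_def mult_ac)
  qed
  show christoffel_coeff: "hpoly n (maj n) (christoffel_coeff n i j k)" if "i \<in> Basis" "j \<in> Basis" "k \<in> Basis" for n i j k
    using that
  proof (induction n arbitrary: i j k rule: less_induct)
    case (less n)
    show ?case
    proof (cases n)
      case 0
      then show ?thesis by (simp add: hpoly_zero)
    next
      case (Suc m)
      have "hpoly m (quad_norm * (\<Sum>a\<le>m. maj a * maj (m - a))) (quad_coeff m i j)"
        using less Suc by (intro quad) auto
      then have Q: "hpoly (Suc m) (quad_norm * (\<Sum>a\<le>m. maj a * maj (m - a))) (antideriv k (quad_coeff m i j))"
        by (rule hpoly_antideriv[OF less.prems(3)])
      have "hpoly (Suc m) (if m = 0 then L_norm else 0) (\<lambda>P. if m = 0 then L P i j \<bullet> k else 0)"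
        using hpoly_L[OF less.prems] hpoly_zero[of 0 "Suc m"] by (cases "m = 0") auto
      moreover have "hpoly (Suc m) (quad_norm * (\<Sum>a\<le>m. maj a * maj (m - a)))
        (\<lambda>P. if k = third_basis i j then antideriv k (quad_coeff m i j) P else 0)"
        using Q hpoly_zero[OF hpoly_nonneg[OF Q]] by (cases "k = third_basis i j") auto
      ultimately show ?thesis
        unfolding Suc christoffel_coeff_Suc majorant.simps by (rule hpoly.add)
    qed
  qed
  show "i \<in> Basis \<Longrightarrow> j \<in> Basis \<Longrightarrow>
    hpoly n (quad_norm * (\<Sum>a\<le>n. maj a * maj (n - a))) (quad_coeff n i j)"
    by (rule quad) (auto intro: christoffel_coeff)
qed

lemma analytic_series_christoffel_coeff:
  assumes "i \<in> Basis" "j \<in> Basis" "k \<in> Basis"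
  shows "analytic_series radius (\<lambda>n. christoffel_coeff n i j k)"
  unfolding analytic_series_def
  using hpoly_christoffel_coeff_quad_coeff(1)[OF assms] majorant_summable[OF L_norm_nonneg quad_norm_pos]
  by (intro exI[of _ maj]) (auto simp: radius_def)

definition christoffel :: "'a \<Rightarrow> 'a \<Rightarrow> 'a \<Rightarrow> 'a \<Rightarrow> real" where
  "christoffel i j k P = (\<Sum>n. christoffel_coeff n i j k P)"

lemma christoffel_sym: "christoffel i j k P = christoffel j i k P"
  by (simp add: christoffel_def christoffel_coeff_sym[of _ i j])

text \<open>
  The correction of \<open>L\<close> lives in the component \<open>third_basis i j\<close> only.
\<close>

lemma christoffel_eq_L:
  assumes "k \<noteq> third_basis i j"
  shows "christoffel i j k = (\<lambda>P. L P i j \<bullet> k)"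
proof
  fix P
  have "christoffel i j k P = (\<Sum>n\<in>{Suc 0}. christoffel_coeff n i j k P)"
    unfolding christoffel_def
  proof (rule suminf_finite)
    fix n :: nat assume "n \<notin> {Suc 0}"
    then show "christoffel_coeff n i j k P = 0" using assms by (cases n) (auto simp: christoffel_coeff_Suc)
  qed simp
  then show "christoffel i j k P = L P i j \<bullet> k" using assms by (simp add: christoffel_coeff_Suc)
qed

lemma christoffel_coeff_partials:
  assumes ijk: "i \<in> Basis" "j \<in> Basis" "k \<in> Basis"
  obtains g where "\<And>b. analytic_series radius (g b)"
    and "\<And>n P. (christoffel_coeff (Suc n) i j k has_derivative (\<lambda>v. \<Sum>b\<in>Basis. (v \<bullet> b) * g b n P)) (at P)"
    and "\<And>P. norm P < radius \<Longrightarrow> (christoffel i j k has_derivative (\<lambda>v. \<Sum>b\<in>Basis. (v \<bullet> b) * (\<Sum>n. g b n P))) (at P)"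
  using analytic_series_has_derivative[OF analytic_series_christoffel_coeff[OF ijk]]
  unfolding christoffel_def[abs_def] by blast

lemma christoffel_has_derivative:
  assumes ijk: "i \<in> Basis" "j \<in> Basis" "k \<in> Basis" and P: "norm P < radius"
  shows "(christoffel i j k has_derivative frechet_derivative (christoffel i j k) (at P)) (at P)"
proof (rule christoffel_coeff_partials[OF ijk])
  fix g assume "\<And>P. norm P < radius \<Longrightarrow>
      (christoffel i j k has_derivative (\<lambda>v. \<Sum>b\<in>Basis. (v \<bullet> b) * (\<Sum>n. g b n P))) (at P)"
  from this[OF P] show ?thesis
    using frechet_derivative_works differentiableI by blast
qed

lemma christoffel_at_0:
  assumes ijk: "i \<in> Basis" "j \<in> Basis" "k \<in> Basis"
  shows "christoffel i j k 0 = 0"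
proof -
  have "christoffel_coeff n i j k 0 = 0" for n
    using hpoly_at_0[OF hpoly_christoffel_coeff_quad_coeff(1)[OF ijk]] by (cases n) (simp, blast)
  then show ?thesis by (simp add: christoffel_def)
qed

lemma L_has_derivative: "((\<lambda>P. L P i j \<bullet> k) has_derivative (\<lambda>v. L v i j \<bullet> k)) (at P)"
  by (intro has_derivative_inner_left linear_imp_has_derivative L_linear)

lemma christoffel_derivative_at_0:
  assumes ijk: "i \<in> Basis" "j \<in> Basis" "k \<in> Basis"
  shows "frechet_derivative (christoffel i j k) (at 0) v = L v i j \<bullet> k"
proof (rule christoffel_coeff_partials[OF ijk])
  fix g assume g: "\<And>b. analytic_series radius (g b)"
    and christoffel_coeff': "\<And>n P. (christoffel_coeff (Suc n) i j k has_derivative (\<lambda>v. \<Sum>b\<in>Basis. (v \<bullet> b) * g b n P)) (at P)"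
    and christoffel': "\<And>P. norm P < radius \<Longrightarrow>
      (christoffel i j k has_derivative (\<lambda>v. \<Sum>b\<in>Basis. (v \<bullet> b) * (\<Sum>n. g b n P))) (at P)"
  have "(\<Sum>n. g b n 0) = (\<Sum>n\<in>{0}. g b n 0)" for b
  proof (rule suminf_finite)
    fix n :: nat assume "n \<notin> {0}"
    then show "g b n 0 = 0"
      using g[of b] hpoly_at_0 unfolding analytic_series_def by (cases n) auto
  qed simp
  (* At 0 only the constant terms of the partial derivatives survive; they come from the linear part. *)
  then have "frechet_derivative (christoffel i j k) (at 0) v = (\<Sum>b\<in>Basis. (v \<bullet> b) * g b 0 0)"
    using fun_cong[OF frechet_derivative_at[OF christoffel'[of 0]], of v] radius_pos by simp
  moreover have quad_0: "quad_coeff 0 i j = (\<lambda>P. 0)"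
    by (simp add: quad_coeff_def fun_eq_iff)
  have "christoffel_coeff (Suc 0) i j k = (\<lambda>P. L P i j \<bullet> k)"
    unfolding christoffel_coeff_Suc quad_0 antideriv_zero by simp
  from fun_cong[OF has_derivative_unique[OF L_has_derivative christoffel_coeff'[of 0 0, unfolded this]], of v]
  have "L v i j \<bullet> k = (\<Sum>b\<in>Basis. (v \<bullet> b) * g b 0 0)" .
  ultimately show ?thesis by simp
qed

lemma quad_coeff_sums:
  assumes "i \<in> Basis" "j \<in> Basis" "norm P < radius"
  shows "(\<lambda>n. quad_coeff n i j P) sums
    (\<Sum>p\<in>Basis. \<Sum>q\<in>Basis. christoffel i q p P * christoffel j p q P - christoffel q p q P * christoffel i j p P)"
proof -
  have "(\<lambda>n. \<Sum>a\<le>n. christoffel_coeff a i j k P * christoffel_coeff (n - a) i' j' k' P) sums (christoffel i j k P * christoffel i' j' k' P)"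
    if "i \<in> Basis" "j \<in> Basis" "k \<in> Basis" "i' \<in> Basis" "j' \<in> Basis" "k' \<in> Basis" for i j k i' j' k'
    unfolding christoffel_def
    using analytic_series_summable[OF analytic_series_christoffel_coeff assms(3)] that
    by (intro Cauchy_product_sums) auto
  then show ?thesis
    unfolding quad_coeff_def using assms by (intro sums_sum sums_diff) auto
qed

text \<open>
  The divergence equation \<open>\<partial>\<^sub>k \<Gamma>\<^sup>k\<^sub>i\<^sub>j = \<partial>\<^sub>k L\<^sup>k\<^sub>i\<^sub>j + Q\<^sub>i\<^sub>j\<close> for \<open>k = third_basis i j\<close>, summed from its homogeneous parts:
  differentiation undoes \<open>antideriv\<close>, and \<open>Q\<close> is a Cauchy product.
\<close>

lemma christoffel_derivative_third:
  assumes ij: "i \<in> Basis" "j \<in> Basis" and P: "norm P < radius"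
  defines "k \<equiv> third_basis i j"
  shows "frechet_derivative (christoffel i j k) (at P) k = L k i j \<bullet> k +
    (\<Sum>p\<in>Basis. \<Sum>q\<in>Basis. christoffel i q p P * christoffel j p q P - christoffel q p q P * christoffel i j p P)"
proof -
  have k: "k \<in> Basis" using third_basis(1)[OF dim] by (simp add: k_def)
  show ?thesis
  proof (rule christoffel_coeff_partials[OF ij k])
    fix g assume christoffel_coeff': "\<And>n P. (christoffel_coeff (Suc n) i j k has_derivative (\<lambda>v. \<Sum>b\<in>Basis. (v \<bullet> b) * g b n P)) (at P)"
      and christoffel': "\<And>P. norm P < radius \<Longrightarrow>
        (christoffel i j k has_derivative (\<lambda>v. \<Sum>b\<in>Basis. (v \<bullet> b) * (\<Sum>n. g b n P))) (at P)"
    have "g k n P = (if n = 0 then L k i j \<bullet> k else 0) + quad_coeff n i j P" for n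
    proof -
      obtain F where F: "(antideriv k (quad_coeff n i j) has_derivative F) (at P)"
        and Fk: "F k = quad_coeff n i j P"
        using antideriv_has_derivative[OF k hpoly_christoffel_coeff_quad_coeff(2)[OF ij]] by blast
      have "((\<lambda>P. if n = 0 then L P i j \<bullet> k else 0) has_derivative
          (\<lambda>v. if n = 0 then L v i j \<bullet> k else 0)) (at P)"
        using L_has_derivative by (cases "n = 0") auto
      from has_derivative_add[OF this F]
      have "(christoffel_coeff (Suc n) i j k has_derivative
          (\<lambda>v. (if n = 0 then L v i j \<bullet> k else 0) + F v)) (at P)"
        by (simp add: christoffel_coeff_Suc flip: k_def)
      from fun_cong[OF has_derivative_unique[OF this christoffel_coeff'], of k] show ?thesis
        by (simp only: sum_inner_Basis[OF k] Fk)
    qed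
    moreover have "(\<lambda>n. (if n = 0 then L k i j \<bullet> k else 0) + quad_coeff n i j P) sums
      (L k i j \<bullet> k + (\<Sum>p\<in>Basis. \<Sum>q\<in>Basis. christoffel i q p P * christoffel j p q P - christoffel q p q P * christoffel i j p P))"
      by (intro sums_add quad_coeff_sums ij P sums_single)
    moreover have "frechet_derivative (christoffel i j k) (at P) k = (\<Sum>n. g k n P)"
      using fun_cong[OF frechet_derivative_at[OF christoffel'[OF P]], of k] sum_inner_Basis[OF k, of "\<lambda>b. \<Sum>n. g b n P"]
      by simp
    ultimately show ?thesis by (simp add: sums_iff)
  qed
qed

end

section \<open>The Ricci tensor of the local solution\<close>

definition bilinear_of :: "('a \<Rightarrow> 'a \<Rightarrow> 'a \<Rightarrow> real) \<Rightarrow> 'a \<Rightarrow> 'a \<Rightarrow> 'a::euclidean_space" where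
  "bilinear_of c x y = (\<Sum>k\<in>Basis. (\<Sum>i\<in>Basis. \<Sum>j\<in>Basis. c i j k * ((x \<bullet> i) * (y \<bullet> j))) *\<^sub>R k)"

lemma bilinear_bilinear_of: "bilinear (bilinear_of c)"
  unfolding bilinear_def bilinear_of_def
  by (auto intro!: linearI simp: inner_add_left algebra_simps sum.distrib
      scaleR_sum_right sum_distrib_left scaleR_sum_left)

lemma bilinear_of_Basis:
  assumes "i \<in> Basis" "j \<in> Basis" "k \<in> Basis"
  shows "bilinear_of c i j \<bullet> k = c i j k"
proof -
  have "bilinear_of c i j \<bullet> k = (\<Sum>i'\<in>Basis. \<Sum>j'\<in>Basis. c i' j' k * ((i \<bullet> i') * (j \<bullet> j')))"
    using assms(3) by (simp add: bilinear_of_def)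
  also have "\<dots> = (\<Sum>i'\<in>Basis. (i \<bullet> i') * (\<Sum>j'\<in>Basis. (j \<bullet> j') * c i' j' k))"
    by (simp add: sum_distrib_left mult_ac)
  also have "\<dots> = c i j k"
    by (simp add: sum_inner_Basis assms)
  finally show ?thesis .
qed

context linear_christoffel
begin

definition Gamma :: "'a \<Rightarrow> 'a \<Rightarrow> 'a \<Rightarrow> 'a" where
  "Gamma P = bilinear_of (\<lambda>i j k. christoffel i j k P)"

definition dGamma :: "'a \<Rightarrow> 'a \<Rightarrow> 'a \<Rightarrow> 'a \<Rightarrow> 'a" where
  "dGamma P v = bilinear_of (\<lambda>i j k. frechet_derivative (christoffel i j k) (at P) v)"

text \<open>
  The curvature of the connection with Christoffel tensor \<open>Gamma\<close> on the ball of convergence.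
\<close>

definition local_curvature :: "'a \<Rightarrow> 'a \<Rightarrow> 'a \<Rightarrow> 'a \<Rightarrow> 'a" where
  "local_curvature P x y z =
    dGamma P x y z - dGamma P y x z + Gamma P x (Gamma P y z) - Gamma P y (Gamma P x z)"

lemma linear_Gamma: "linear (\<lambda>x. Gamma P x y)" "linear (Gamma P x)"
  and linear_dGamma: "linear (\<lambda>x. dGamma P v x y)" "linear (dGamma P v x)"
  using bilinear_bilinear_of unfolding Gamma_def dGamma_def bilinear_def by blast+

lemma Gamma_sym: "Gamma P x y = Gamma P y x"
  unfolding Gamma_def bilinear_of_def christoffel_sym[of _ _ _ P]
  by (subst sum.swap) (simp add: mult.commute christoffel_sym)

lemma Gamma_has_derivative:
  assumes "norm P < radius"
  shows "((\<lambda>P. Gamma P x y) has_derivative (\<lambda>v. dGamma P v x y)) (at P)"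
  unfolding Gamma_def dGamma_def bilinear_of_def
  by (intro has_derivative_sum has_derivative_scaleR_left has_derivative_mult_left
      christoffel_has_derivative assms)

lemma linear_dGamma_direction: "norm P < radius \<Longrightarrow> linear (\<lambda>v. dGamma P v x y)"
  using Gamma_has_derivative has_derivative_linear by blast

lemma Gamma_Basis: "i \<in> Basis \<Longrightarrow> j \<in> Basis \<Longrightarrow> k \<in> Basis \<Longrightarrow> Gamma P i j \<bullet> k = christoffel i j k P"
  and dGamma_Basis: "i \<in> Basis \<Longrightarrow> j \<in> Basis \<Longrightarrow> k \<in> Basis \<Longrightarrow>
    dGamma P v i j \<bullet> k = frechet_derivative (christoffel i j k) (at P) v"
  by (simp_all add: Gamma_def dGamma_def bilinear_of_Basis)

lemma Gamma_Gam_Basis: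
  assumes "i \<in> Basis" "p \<in> Basis" "q \<in> Basis" "k \<in> Basis"
  shows "Gamma P i (Gamma P p q) \<bullet> k = (\<Sum>b\<in>Basis. christoffel p q b P * christoffel i b k P)"
  using assms
  by (subst linear_eq_sum_Basis[OF linear_Gamma(2)]) (simp add: inner_sum_left Gamma_Basis)

lemma L_linear_left: "linear (\<lambda>x. L P x y)"
  using L_linear_right[of P y] by (simp add: L_sym[of P _ y])

lemma frechet_derivative_L:
  "frechet_derivative (\<lambda>P. L P i j \<bullet> k) (at P) v = L v i j \<bullet> k"
  using fun_cong[OF frechet_derivative_at[OF L_has_derivative]] by (rule sym)

text \<open>
  The four groups of terms of the Ricci tensor: the divergence contributes its linear part and \<open>Q\<close>
  (\<open>div\<close>), the trace contributes only its linear part since \<open>third_basis b j \<noteq> b\<close> (\<open>trace\<close>), and the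
  quadratic terms are exactly \<open>- Q\<close> (\<open>quad\<close>).
\<close>

lemma ricci_local_curvature_Basis:
  assumes P: "norm P < radius" and i: "i \<in> Basis" and j: "j \<in> Basis"
  shows "ricci (local_curvature P) i j = ricci (\<lambda>x y z. L x y z - L y x z) i j"
proof -
  define t where "t = third_basis i j"
  define Q where "Q = (\<Sum>p\<in>Basis. \<Sum>q\<in>Basis. christoffel i q p P * christoffel j p q P - christoffel q p q P * christoffel i j p P)"
  have t: "t \<in> Basis" using third_basis(1)[OF dim] by (simp add: t_def)
  have "frechet_derivative (christoffel i j b) (at P) b = L b i j \<bullet> b + (if b = t then Q else 0)" for b
  proof (cases "b = t")
    case True
    then show ?thesis using christoffel_derivative_third[OF i j P] by (simp add: t_def Q_def)
  next
    case False
    then show ?thesis by (simp add: christoffel_eq_L t_def frechet_derivative_L)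
  qed
  then have div: "(\<Sum>b\<in>Basis. dGamma P b i j \<bullet> b) = (\<Sum>b\<in>Basis. L b i j \<bullet> b) + Q"
    using t by (simp add: dGamma_Basis i j sum.distrib)
  have "frechet_derivative (christoffel b j b) (at P) i = L i b j \<bullet> b" for b
    using third_basis(2)[OF dim, of b j] by (simp add: christoffel_eq_L frechet_derivative_L)
  then have trace: "(\<Sum>b\<in>Basis. dGamma P i b j \<bullet> b) = (\<Sum>b\<in>Basis. L i b j \<bullet> b)"
    by (simp add: dGamma_Basis j)
  have quad: "(\<Sum>b\<in>Basis. Gamma P i (Gamma P b j) \<bullet> b) - (\<Sum>b\<in>Basis. Gamma P b (Gamma P i j) \<bullet> b) = Q"
  proof -
    have "(\<Sum>b\<in>Basis. Gamma P b (Gamma P i j) \<bullet> b) = (\<Sum>p\<in>Basis. \<Sum>q\<in>Basis. christoffel q p q P * christoffel i j p P)"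
      by (subst sum.swap) (simp add: Gamma_Gam_Basis i j mult.commute)
    moreover have "(\<Sum>b\<in>Basis. Gamma P i (Gamma P b j) \<bullet> b) =
        (\<Sum>p\<in>Basis. \<Sum>q\<in>Basis. christoffel i q p P * christoffel j p q P)"
      by (simp add: Gamma_Gam_Basis i j mult.commute christoffel_sym[of _ j])
    ultimately show ?thesis by (simp add: Q_def sum_subtractf)
  qed
  have "ricci (local_curvature P) i j =
      (\<Sum>b\<in>Basis. dGamma P b i j \<bullet> b) - (\<Sum>b\<in>Basis. dGamma P i b j \<bullet> b)
        + (\<Sum>b\<in>Basis. Gamma P b (Gamma P i j) \<bullet> b) - (\<Sum>b\<in>Basis. Gamma P i (Gamma P b j) \<bullet> b)"
    by (simp add: ricci_def endo_trace_def local_curvature_def inner_add_left inner_diff_left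
        sum.distrib sum_subtractf)
  also have "\<dots> = (\<Sum>b\<in>Basis. L b i j \<bullet> b) - (\<Sum>b\<in>Basis. L i b j \<bullet> b)"
    unfolding div trace using quad by simp
  finally show ?thesis
    by (simp add: ricci_def endo_trace_def inner_diff_left sum_subtractf)
qed

lemma linear_local_curvature:
  assumes "norm P < radius"
  shows "linear (\<lambda>x. local_curvature P x y z)" "linear (\<lambda>y. local_curvature P x y z)"
    "linear (local_curvature P x y)"
proof -
  note lin = linear_add[OF linear_Gamma(1)] linear_add[OF linear_Gamma(2)] linear_add[OF linear_dGamma(1)]
    linear_add[OF linear_dGamma(2)] linear_add[OF linear_dGamma_direction[OF assms]]
    linear_scale[OF linear_Gamma(1)] linear_scale[OF linear_Gamma(2)] linear_scale[OF linear_dGamma(1)]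
    linear_scale[OF linear_dGamma(2)] linear_scale[OF linear_dGamma_direction[OF assms]]
  show "linear (\<lambda>x. local_curvature P x y z)" "linear (\<lambda>y. local_curvature P x y z)"
    "linear (local_curvature P x y)"
    by (rule linearI; simp add: local_curvature_def lin algebra_simps)+
qed

lemma bilinear_ricci:
  fixes R :: "'a \<Rightarrow> 'a \<Rightarrow> 'a \<Rightarrow> 'a"
  assumes "\<And>x z. linear (\<lambda>y. R x y z)" "\<And>x y. linear (R x y)"
  shows "bilinear (ricci R)"
  unfolding bilinear_def ricci_def endo_trace_def
  by (auto intro!: linearI simp: linear_add[OF assms(1)] linear_add[OF assms(2)]
      linear_scale[OF assms(1)] linear_scale[OF assms(2)] inner_add_left sum.distrib sum_distrib_left)

end

section \<open>A diffeomorphism of the space onto a bounded cube\<close>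

definition slope :: "real \<Rightarrow> real \<Rightarrow> real" where
  "slope \<rho> t = inverse (1 + (t / \<rho>)\<^sup>2)"

text \<open>
  Applied coordinatewise, \<open>t \<mapsto> \<rho> arctan (t / \<rho>)\<close> is bounded and has derivative \<open>1\<close> at \<open>0\<close>. Its derivative is the rational
  function \<open>slope\<close>, whose reciprocal is a polynomial, so smoothness of the derivative map
  \<open>dsquash\<close> and of its inverse is immediate.
\<close>

definition squash :: "real \<Rightarrow> 'a::euclidean_space \<Rightarrow> 'a" where
  "squash \<rho> u = (\<Sum>b\<in>Basis. (\<rho> * arctan ((u \<bullet> b) / \<rho>)) *\<^sub>R b)"

definition dsquash :: "real \<Rightarrow> 'a::euclidean_space \<Rightarrow> 'a \<Rightarrow> 'a" where
  "dsquash \<rho> u v = (\<Sum>b\<in>Basis. (slope \<rho> (u \<bullet> b) * (v \<bullet> b)) *\<^sub>R b)"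

definition dsquash_inv :: "real \<Rightarrow> 'a::euclidean_space \<Rightarrow> 'a \<Rightarrow> 'a" where
  "dsquash_inv \<rho> u v = (\<Sum>b\<in>Basis. (inverse (slope \<rho> (u \<bullet> b)) * (v \<bullet> b)) *\<^sub>R b)"

lemma slope_pos: "0 < slope \<rho> t"
  by (simp add: slope_def add_pos_nonneg)

lemma slope_nonzero [simp]: "slope \<rho> t \<noteq> 0"
  using slope_pos[of \<rho> t] by simp

lemma smooth_slope: "smooth (\<lambda>u. slope \<rho> (u \<bullet> b))"
proof -
  have "1 + (t / \<rho>)\<^sup>2 \<noteq> 0" for t :: real
    by (smt (verit) zero_le_power2)
  then show ?thesis
    unfolding slope_def power2_eq_square divide_inverse
    by (intro smooth_inverse smooth_intros)
qed

lemma dsquash_inner: "b \<in> Basis \<Longrightarrow> dsquash \<rho> u v \<bullet> b = slope \<rho> (u \<bullet> b) * (v \<bullet> b)"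
  and dsquash_inv_inner: "b \<in> Basis \<Longrightarrow> dsquash_inv \<rho> u v \<bullet> b = inverse (slope \<rho> (u \<bullet> b)) * (v \<bullet> b)"
  by (simp_all add: dsquash_def dsquash_inv_def)

lemma dsquash_Basis: "b \<in> Basis \<Longrightarrow> dsquash \<rho> u b = slope \<rho> (u \<bullet> b) *\<^sub>R b"
  by (rule euclidean_eqI) (simp add: dsquash_inner inner_Basis)

lemma dsquash_inverse: "dsquash \<rho> u (dsquash_inv \<rho> u v) = v" "dsquash_inv \<rho> u (dsquash \<rho> u v) = v"
  by (rule euclidean_eqI; simp add: dsquash_inner dsquash_inv_inner)+

lemma linear_dsquash: "linear (dsquash \<rho> u)" "linear (dsquash_inv \<rho> u)"
  by (rule linearI; rule euclidean_eqI;
      simp add: dsquash_inner dsquash_inv_inner inner_add_left distrib_left mult.left_commute)+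

lemma smooth_dsquash: "smooth X \<Longrightarrow> smooth (\<lambda>u. dsquash \<rho> u (X u))"
  and smooth_dsquash_inv: "smooth X \<Longrightarrow> smooth (\<lambda>u. dsquash_inv \<rho> u (X u))"
  unfolding dsquash_def dsquash_inv_def
  by (intro smooth_intros smooth_inverse smooth_slope; simp)+

lemma squash_has_derivative:
  assumes "0 < \<rho>"
  shows "(squash \<rho> has_derivative dsquash \<rho> u) (at u)"
proof -
  have "((\<lambda>t. \<rho> * arctan (t / \<rho>)) has_real_derivative slope \<rho> t) (at t)" for t
    using assms by (auto intro!: derivative_eq_intros simp: slope_def)
  then have "((\<lambda>t. \<rho> * arctan (t / \<rho>)) has_derivative (\<lambda>s. slope \<rho> t * s)) (at t)" for t
    by (simp only: has_field_derivative_def)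
  then show ?thesis
    unfolding squash_def[abs_def] dsquash_def[abs_def]
    by (intro has_derivative_sum has_derivative_scaleR_left
        has_derivative_compose[where f = "\<lambda>u. u \<bullet> _", OF has_derivative_inner_left[OF has_derivative_ident]])
qed

lemma smooth_squash: "0 < \<rho> \<Longrightarrow> smooth (squash \<rho>)"
  by (rule smooth_if_smooth_derivative[OF squash_has_derivative]) (auto intro: smooth_dsquash)

lemma norm_squash_less:
  assumes "0 < \<rho>"
  shows "norm (squash \<rho> (u::'a::euclidean_space)) < 2 * \<rho> * DIM('a)"
proof -
  have "norm (squash \<rho> u) \<le> (\<Sum>b\<in>(Basis::'a set). \<bar>\<rho> * arctan ((u \<bullet> b) / \<rho>)\<bar>)"
    unfolding squash_def by (rule sum_norm_le) simp
  also have "\<dots> < (\<Sum>b\<in>(Basis::'a set). 2 * \<rho>)"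
  proof (rule sum_strict_mono)
    fix b :: 'a
    have "\<bar>arctan ((u \<bullet> b) / \<rho>)\<bar> < 2"
      using arctan_bounded[of "(u \<bullet> b) / \<rho>"] pi_less_4 by linarith
    then show "\<bar>\<rho> * arctan ((u \<bullet> b) / \<rho>)\<bar> < 2 * \<rho>"
      using assms by (simp add: abs_mult)
  qed auto
  finally show ?thesis by (simp add: mult.commute)
qed

lemma squash_0: "squash \<rho> 0 = 0" and dsquash_0: "dsquash \<rho> 0 v = v" and dsquash_inv_0: "dsquash_inv \<rho> 0 v = v"
  by (simp_all add: squash_def dsquash_def dsquash_inv_def slope_def euclidean_representation)

text \<open>
  These are second and third derivatives of \<open>squash\<close>. Since \<open>squash\<close> acts on each coordinate
  separately, they are diagonal multilinear forms and visibly symmetric.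
\<close>

lemma dsquash_derivatives_sym:
  fixes u x y z :: "'a::euclidean_space"
  assumes "0 < \<rho>"
  shows "frechet_derivative (\<lambda>u. dsquash \<rho> u y) (at u) x =
      frechet_derivative (\<lambda>u. dsquash \<rho> u x) (at u) y"
    and "frechet_derivative (\<lambda>u. frechet_derivative (\<lambda>u. dsquash \<rho> u z) (at u) y) (at u) x =
      frechet_derivative (\<lambda>u. frechet_derivative (\<lambda>u. dsquash \<rho> u z) (at u) x) (at u) y"
proof -
  define c where "c = - 2 / \<rho>\<^sup>2"
  define s1 where "s1 = (\<lambda>t. c * (t * (slope \<rho> t)\<^sup>2))"
  define s2 where "s2 = (\<lambda>t. c * ((slope \<rho> t)\<^sup>2 + t * (2 * slope \<rho> t * s1 t)))"
  have nz: "1 + (t / \<rho>)\<^sup>2 \<noteq> 0" for t :: real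
    by (smt (verit) zero_le_power2)
  have s1: "(slope \<rho> has_real_derivative s1 t) (at t)" for t
  proof -
    have "((\<lambda>t. 1 + (t / \<rho>)\<^sup>2) has_real_derivative 2 * t / \<rho>\<^sup>2) (at t)"
      using assms by (auto intro!: derivative_eq_intros simp: power2_eq_square)
    from DERIV_inverse'[OF this nz] show ?thesis
      unfolding slope_def[abs_def] s1_def c_def by (simp add: power2_eq_square mult_ac)
  qed
  have s2: "(s1 has_real_derivative s2 t) (at t)" for t
    unfolding s1_def by (auto intro!: derivative_eq_intros s1 simp: s2_def s1_def algebra_simps)
  have "((\<lambda>u. \<Sum>b\<in>Basis. (s (u \<bullet> b) * c b) *\<^sub>R b) has_derivative
      (\<lambda>x. \<Sum>b\<in>Basis. (s' (u \<bullet> b) * (x \<bullet> b) * c b) *\<^sub>R b)) (at u)"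
    if "\<And>t. (s has_real_derivative s' t) (at t)" for s s' c and u :: 'a
    by (intro has_derivative_sum has_derivative_scaleR_left has_derivative_mult_left
        has_derivative_compose[where f = "\<lambda>u. u \<bullet> _", OF has_derivative_inner_left[OF has_derivative_ident]]
        that[THEN has_field_derivative_imp_has_derivative])
  note D = frechet_derivative_at[OF this, symmetric]
  have d1: "frechet_derivative (\<lambda>u::'a. dsquash \<rho> u y) (at u) =
      (\<lambda>x. \<Sum>b\<in>Basis. (s1 (u \<bullet> b) * (x \<bullet> b) * (y \<bullet> b)) *\<^sub>R b)" for y u
    unfolding dsquash_def by (rule D[OF s1])
  have d2: "frechet_derivative (\<lambda>u::'a. frechet_derivative (\<lambda>u. dsquash \<rho> u z) (at u) y) (at u) x =
      (\<Sum>b\<in>Basis. (s2 (u \<bullet> b) * (x \<bullet> b) * (y \<bullet> b) * (z \<bullet> b)) *\<^sub>R b)" for x y z u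
    unfolding d1 using D[OF s2, of "\<lambda>b. (y \<bullet> b) * (z \<bullet> b)"] by (simp add: mult.assoc)
  show "frechet_derivative (\<lambda>u. dsquash \<rho> u y) (at u) x = frechet_derivative (\<lambda>u. dsquash \<rho> u x) (at u) y"
    by (simp add: d1 mult_ac)
  show "frechet_derivative (\<lambda>u. frechet_derivative (\<lambda>u. dsquash \<rho> u z) (at u) y) (at u) x =
      frechet_derivative (\<lambda>u. frechet_derivative (\<lambda>u. dsquash \<rho> u z) (at u) x) (at u) y"
    unfolding d2 by (simp add: mult_ac)
qed

section \<open>The connection on the whole space\<close>

context linear_christoffel
begin

text \<open>
  By \<open>norm_squash_less\<close> this choice makes \<open>squash width\<close> take values in the ball of convergence.
\<close>

definition width :: real where
  "width = radius / (2 * DIM('a))"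

lemma width_pos: "0 < width"
  using radius_pos by (simp add: width_def)

lemma norm_squash_radius: "norm (squash width u :: 'a) < radius"
  using norm_squash_less[OF width_pos, of u] by (simp add: width_def)

lemma frame_connection_pullback:
  "frame_connection (dsquash width) (dsquash_inv width) (\<lambda>u. Gamma (squash width u))"
proof (rule frame_connection.intro)
  fix u x y z v w :: 'a and X Y :: "'a \<Rightarrow> 'a"
  show "linear (dsquash width u)" "linear (dsquash_inv width u)" by (fact linear_dsquash)+
  show "dsquash width u (dsquash_inv width u v) = v" "dsquash_inv width u (dsquash width u v) = v"
    by (fact dsquash_inverse)+
  show "smooth (\<lambda>u. dsquash width u (X u))" if "smooth X"
    using that by (rule smooth_dsquash)
  show "smooth (\<lambda>u. dsquash_inv width u (X u))" if "smooth X"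
    using that by (rule smooth_dsquash_inv)
  show "linear (\<lambda>v. Gamma (squash width u) v w)" "linear (Gamma (squash width u) v)" by (fact linear_Gamma)+
  show "Gamma (squash width u) v w = Gamma (squash width u) w v" by (rule Gamma_sym)
  have "smooth (\<lambda>u. christoffel i j k (squash width u))" if "i \<in> Basis" "j \<in> Basis" "k \<in> Basis" for i j k
    unfolding christoffel_def
    by (rule smooth_analytic_series[OF smooth_squash[OF width_pos] norm_squash_radius analytic_series_christoffel_coeff[OF that]])
  then show "smooth (\<lambda>u. Gamma (squash width u) (X u) (Y u))" if "smooth X" "smooth Y"
    unfolding Gamma_def bilinear_of_def using that by (intro smooth_intros) auto
  show "frechet_derivative (\<lambda>u. dsquash width u y) (at u) x = frechet_derivative (\<lambda>u. dsquash width u x) (at u) y"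
    "frechet_derivative (\<lambda>u. frechet_derivative (\<lambda>u. dsquash width u z) (at u) y) (at u) x =
     frechet_derivative (\<lambda>u. frechet_derivative (\<lambda>u. dsquash width u z) (at u) x) (at u) y"
    by (fact dsquash_derivatives_sym[OF width_pos])+
qed

definition nabla :: "('a \<Rightarrow> 'a) \<Rightarrow> ('a \<Rightarrow> 'a) \<Rightarrow> 'a \<Rightarrow> 'a" where
  "nabla = frame_connection.cov (dsquash width) (dsquash_inv width) (\<lambda>u. Gamma (squash width u))"

lemma torsion_free_nabla: "torsion_free_connection nabla"
proof -
  interpret frame_connection "dsquash width" "dsquash_inv width" "\<lambda>u. Gamma (squash width u)"
    by (rule frame_connection_pullback)
  show ?thesis unfolding nabla_def by unfold_locales
qed

text \<open>
  The chain rule turns the derivative of \<open>u \<mapsto> Gamma (squash width u)\<close> along \<open>x\<close> into \<open>dGamma\<close> along \<open>dsquash width u x\<close>, so every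
  argument of the local curvature is transported by \<open>dsquash\<close>.
\<close>

lemma curvature_at_nabla:
  "curvature_at nabla u x y z = dsquash_inv width u
    (local_curvature (squash width u) (dsquash width u x) (dsquash width u y) (dsquash width u z))"
proof -
  interpret frame_connection "dsquash width" "dsquash_inv width" "\<lambda>u. Gamma (squash width u)"
    by (rule frame_connection_pullback)
  have "frechet_derivative (\<lambda>u. Gamma (squash width u) v w) (at u) x = dGamma (squash width u) (dsquash width u x) v w" for v w x
    by (rule fun_cong[OF frechet_derivative_at[symmetric]],
        rule has_derivative_compose[OF squash_has_derivative[OF width_pos] Gamma_has_derivative[OF norm_squash_radius]])
  then show ?thesis
    by (simp add: nabla_def curvature_at_cov local_curvature_def)
qed

text \<open>
  Conjugation by \<open>dsquash\<close> does not change the trace; as \<open>dsquash\<close> is diagonal, this holds summand by summand.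
\<close>

lemma ricci_nabla:
  "ricci (curvature_at nabla u) x y =
    ricci (\<lambda>x y z. L x y z - L y x z) (dsquash width u x) (dsquash width u y)"
proof -
  let ?R = "local_curvature (squash width u)" and ?D = "dsquash width u"
  note lin = linear_local_curvature[OF norm_squash_radius]
  have "ricci ?R = ricci (\<lambda>x y z. L x y z - L y x z)"
    by (rule bilinear_eq_stdbasis[OF bilinear_ricci[OF lin(2,3)] bilinear_ricci])
      (intro linear_compose_sub L_linear L_linear_left L_linear_right ricci_local_curvature_Basis
        norm_squash_radius; assumption)+
  moreover have "ricci (curvature_at nabla u) x y = ricci ?R (?D x) (?D y)"
    unfolding ricci_def endo_trace_def
  proof (rule sum.cong[OF refl])
    fix b :: 'a assume b: "b \<in> Basis"
    show "curvature_at nabla u b x y \<bullet> b = ?R b (?D x) (?D y) \<bullet> b"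
      using slope_pos[of width "u \<bullet> b"]
      by (simp add: curvature_at_nabla dsquash_inv_inner[OF b] dsquash_Basis[OF b] linear_scale[OF lin(1)])
  qed
  ultimately show ?thesis by simp
qed

text \<open>
  At \<open>0\<close> the Christoffel symbols vanish and their first derivatives are those of \<open>L\<close>.
\<close>

lemma curvature_at_nabla_0: "curvature_at nabla 0 x y z = L x y z - L y x z"
proof -
  have dGamma: "dGamma 0 v = L v" for v
  proof (rule bilinear_eq_stdbasis)
    show "bilinear (dGamma 0 v)" "bilinear (L v)"
      by (simp_all add: bilinear_def linear_dGamma L_linear_left L_linear_right)
    show "dGamma 0 v i j = L v i j" if "i \<in> Basis" "j \<in> Basis" for i j
      using that by (intro euclidean_eqI[where 'a = 'a]) (simp only: dGamma_Basis christoffel_derivative_at_0)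
  qed
  have Gamma: "Gamma 0 x y = 0" for x y
    by (simp add: Gamma_def bilinear_of_def christoffel_at_0)
  show ?thesis
    by (simp add: curvature_at_nabla squash_0 dsquash_0 dsquash_inv_0 local_curvature_def dGamma Gamma)
qed

end

text \<open>
  For \<open>L(P)(x, y) = (A(P,x)y + A(P,y)x) / 3\<close> the Bianchi identity gives \<open>L(x)(y, z) - L(y)(x, z) = A(x,y)z\<close>.
\<close>

lemma exists_connection_ricci:
  fixes A :: "'a::euclidean_space \<Rightarrow> 'a \<Rightarrow> 'a \<Rightarrow> 'a"
  assumes dim: "3 \<le> DIM('a)" and A: "A \<in> curvature_operators"
  obtains nabla D where "torsion_free_connection nabla" "curvature_at nabla 0 = A"
    "\<And>u x y. ricci (curvature_at nabla u) x y = ricci A (D u x) (D u y)"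
proof -
  define L where "L = (\<lambda>P x y. (1 / 3) *\<^sub>R (A P x y + A P y x))"
  have lin: "linear (\<lambda>x. A x y z)" "linear (\<lambda>y. A x y z)" "linear (A x y)"
    and anti: "A x y z = - A y x z" and bianchi: "A x y z + A y z x + A z x y = 0" for x y z
    using A unfolding curvature_operators_def by blast+
  interpret linear_christoffel L
  proof (rule linear_christoffel.intro)
    show "linear (\<lambda>P. L P x y)" "linear (L P x)" for P x y
      unfolding L_def by (intro linear_compose_scale_right linear_compose_add lin)+
  qed (simp_all add: dim L_def add.commute)
  have L_A: "L x y z - L y x z = A x y z" for x y z
  proof -
    have "A x y z + A x z y - (A y x z + A y z x) = 3 *\<^sub>R A x y z"
      using bianchi[of x y z] anti[of y x z] anti[of x z y]
      by (simp add: scaleR_left_distrib[of 2 1, simplified] scaleR_2 add_eq_0_iff algebra_simps)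
    then show ?thesis
      by (simp add: L_def flip: scaleR_diff_right)
  qed
  show thesis
  proof (rule that)
    show "torsion_free_connection nabla" by (rule torsion_free_nabla)
    show "curvature_at nabla 0 = A" by (intro ext) (simp add: curvature_at_nabla_0 L_A)
    show "ricci (curvature_at nabla u) x y = ricci A (dsquash width u x) (dsquash width u y)" for u x y
      by (simp add: ricci_nabla L_A)
  qed
qed

theorem theorem1p4:
  fixes A :: "'a::euclidean_space \<Rightarrow> 'a \<Rightarrow> 'a \<Rightarrow> 'a"
  assumes "DIM('a) \<ge> 3"
    and "A \<in> curvature_operators"
  shows "(ricci_symmetric A \<longrightarrow>
            (\<exists>nabla. torsion_free_connection nabla \<and> ricci_symmetric_connection nabla \<and>
               curvature_at nabla 0 = A)) \<and>
         (ricci_antisymmetric A \<longrightarrow>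
            (\<exists>nabla. torsion_free_connection nabla \<and> ricci_antisymmetric_connection nabla \<and>
               curvature_at nabla 0 = A)) \<and>
         (ricci_flat A \<longrightarrow>
            (\<exists>nabla. torsion_free_connection nabla \<and> ricci_flat_connection nabla \<and>
               curvature_at nabla 0 = A))"
proof -
  obtain nabla D where nabla: "torsion_free_connection nabla" "curvature_at nabla 0 = A"
    and ricci: "\<And>u x y. ricci (curvature_at nabla u) x y = ricci A (D u x) (D u y)"
    using exists_connection_ricci[OF assms] by blast
  show ?thesis
    using nabla ricci
    unfolding ricci_symmetric_connection_def ricci_antisymmetric_connection_def
      ricci_flat_connection_def ricci_symmetric_def ricci_antisymmetric_def ricci_flat_def
    by metis
qed

end
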